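(* Let $n\geq 7$ be an integer such that the congruence $x^2+x+1\equiv 0 \pmod n$ has a solution $r\in\mathbb{Z}_n$, and let $\mathcal{NCG}_{18n^3}$ be the graph defined in the context below. Then $\mathcal{NCG}_{18n^3}$ is a connected cubic symmetric (i.e. arc-transitive) graph which is not a Cayley graph. Moreover, its full automorphism group $\mathrm{Aut}(\mathcal{NCG}_{18n^3})$ is solvable and of type $2^2$.
   Context: Fix $n\ge 7$ and $r\in\mathbb{Z}_n$ with $r^2+r+1\equiv 0\pmod n$. Let $K=\langle a,b,c,h \mid a^n=b^n=c^n=h^3=[a,b]=[a,c]=[b,c]=1,\ a^h=a^r,\ b^h=b^r,\ c^h=c^r\rangle\cong \mathbb{Z}_n^3\rtimes\mathbb{Z}_3$ (here $x^h=h^{-1}xh$), a group of order $3n^3$. Let $\{\mathbf{u},\mathbf{v},\mathbf{w},\mathbf{x},\mathbf{y},\mathbf{z}\}$ be six symbols. The graph $\mathcal{NCG}_{18n^3}$ has vertex set $\{\mathbf{u},\mathbf{v},\mathbf{w},\mathbf{x},\mathbf{y},\mathbf{z}\}\times K$ and edge set consisting, for every $g\in K$, of the edges $\{(\mathbf u,g),(\mathbf x,g)\}$, $\{(\mathbf u,g),(\mathbf y,g)\}$, $\{(\mathbf u,g),(\mathbf z,g)\}$, $\{(\mathbf v,g),(\mathbf x,gh^{-1}b)\}$, $\{(\mathbf v,g),(\mathbf y,g)\}$, $\{(\mathbf v,g),(\mathbf z,gh)\}$, $\{(\mathbf w,g),(\mathbf x,gh^{-1}a)\}$, $\{(\mathbf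 w,g),(\mathbf y,ghc)\}$, $\{(\mathbf w,g),(\mathbf z,g)\}$. An $s$-arc in a graph is a sequence $(v_0,\dots,v_s)$ of vertices with $v_{i-1}$ adjacent to $v_i$ for $1\le i\le s$ and $v_{i-1}\ne v_{i+1}$ for $1\le i<s$. For a connected cubic graph $\Gamma$ and $G\le\mathrm{Aut}(\Gamma)$, $\Gamma$ is $(G,2)$-regular if $G$ acts regularly (transitively with trivial stabilizers) on the set of $2$-arcs. A group $G\le \mathrm{Aut}(\Gamma)$ acting $2$-regularly on a connected cubic graph $\Gamma$ is said to be of type $2^1$ if $G$ contains an involution interchanging the two ends of some edge, and of type $2^2$ otherwise; the automorphism group of $\Gamma$ being "of type $2^2$" means $\Gamma$ is $(\mathrm{Aut}(\Gamma),2)$-regular and $\mathrm{Aut}(\Gamma)$ contains no involution swapping two adjacent vertices. A graph is a Cayley graph iff its automorphism group contains a subgroup acting regularly on the vertex set. *)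

theory Defs
  imports "HOL-Algebra.Bij" "HOL-Algebra.Solvable_Groups"
begin

section \<open>General graph notions (graph = vertex set V + adjacency relation adj)\<close>

definition graph_connected :: "'a set \<Rightarrow> ('a \<Rightarrow> 'a \<Rightarrow> bool) \<Rightarrow> bool" where
  "graph_connected V adj \<longleftrightarrow>
     (\<forall>x\<in>V. \<forall>y\<in>V. (x, y) \<in> {(p, q). p \<in> V \<and> q \<in> V \<and> adj p q}\<^sup>*)"

definition cubic :: "'a set \<Rightarrow> ('a \<Rightarrow> 'a \<Rightarrow> bool) \<Rightarrow> bool" where
  "cubic V adj \<longleftrightarrow> (\<forall>x\<in>V. card {y\<in>V. adj x y} = 3)"

text \<open>Automorphism group: adjacency-preserving bijections of V (extensional, as in BijGroup).\<close>
definition Aut :: "'a set \<Rightarrow> ('a \<Rightarrow> 'a \<Rightarrow> bool) \<Rightarrow> ('a \<Rightarrow> 'a) monoid" where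
  "Aut V adj = (BijGroup V) \<lparr> carrier :=
      {f \<in> Bij V. \<forall>x\<in>V. \<forall>y\<in>V. adj x y \<longleftrightarrow> adj (f x) (f y)} \<rparr>"

text \<open>s-arcs as lists of length s+1.\<close>
definition s_arc :: "'a set \<Rightarrow> ('a \<Rightarrow> 'a \<Rightarrow> bool) \<Rightarrow> nat \<Rightarrow> 'a list \<Rightarrow> bool" where
  "s_arc V adj s p \<longleftrightarrow> length p = s + 1 \<and> set p \<subseteq> V
     \<and> (\<forall>i. 1 \<le> i \<and> i \<le> s \<longrightarrow> adj (p ! (i - 1)) (p ! i))
     \<and> (\<forall>i. 1 \<le> i \<and> i < s \<longrightarrow> p ! (i - 1) \<noteq> p ! (i + 1))"

text \<open>Symmetric = arc-transitive: Aut transitive on 1-arcs.\<close>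
definition arc_transitive :: "'a set \<Rightarrow> ('a \<Rightarrow> 'a \<Rightarrow> bool) \<Rightarrow> bool" where
  "arc_transitive V adj \<longleftrightarrow>
     (\<forall>p q. s_arc V adj 1 p \<and> s_arc V adj 1 q \<longrightarrow>
        (\<exists>f\<in>carrier (Aut V adj). map f p = q))"

text \<open>A set of automorphisms acts regularly on the vertex set.\<close>
definition regular_on_vertices :: "'a set \<Rightarrow> ('a \<Rightarrow> 'a) set \<Rightarrow> bool" where
  "regular_on_vertices V H \<longleftrightarrow> (\<forall>x\<in>V. \<forall>y\<in>V. \<exists>!f. f \<in> H \<and> f x = y)"

definition is_Cayley_graph :: "'a set \<Rightarrow> ('a \<Rightarrow> 'a \<Rightarrow> bool) \<Rightarrow> bool" where
  "is_Cayley_graph V adj \<longleftrightarrow>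
     (\<exists>H. subgroup H (Aut V adj) \<and> regular_on_vertices V H)"

text \<open>(G,2)-regular: G \<le> Aut acts regularly on the 2-arcs.\<close>
definition two_regular :: "'a set \<Rightarrow> ('a \<Rightarrow> 'a \<Rightarrow> bool) \<Rightarrow> ('a \<Rightarrow> 'a) set \<Rightarrow> bool" where
  "two_regular V adj G \<longleftrightarrow> subgroup G (Aut V adj) \<and>
     (\<forall>p q. s_arc V adj 2 p \<and> s_arc V adj 2 q \<longrightarrow> (\<exists>!f. f \<in> G \<and> map f p = q))"

text \<open>Type 2^2: 2-regular and no involution of G interchanges the ends of an edge.\<close>
definition type_2_2 :: "'a set \<Rightarrow> ('a \<Rightarrow> 'a \<Rightarrow> bool) \<Rightarrow> ('a \<Rightarrow> 'a) set \<Rightarrow> bool" where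
  "type_2_2 V adj G \<longleftrightarrow> two_regular V adj G \<and>
     \<not> (\<exists>f\<in>G. f \<noteq> \<one>\<^bsub>Aut V adj\<^esub> \<and> f \<otimes>\<^bsub>Aut V adj\<^esub> f = \<one>\<^bsub>Aut V adj\<^esub>
           \<and> (\<exists>u\<in>V. \<exists>v\<in>V. adj u v \<and> f u = v \<and> f v = u))"

section \<open>The group K = Z_n^3 \<rtimes> Z_3 and the graph NCG_{18n^3}\<close>

text \<open>Element (x,y,z,e) stands for a^x b^y c^z h^e, with x,y,z in {0..n-1}, e in {0,1,2}.
  Since h^{-1} v h = v^r and r^3 = 1 mod n, h^e v h^{-e} = v^{r^(2e)}.\<close>
type_synonym kel = "int \<times> int \<times> int \<times> nat"

definition Kcarrier :: "nat \<Rightarrow> kel set" where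
  "Kcarrier n = {(x, y, z, e). 0 \<le> x \<and> x < int n \<and> 0 \<le> y \<and> y < int n \<and> 0 \<le> z \<and> z < int n \<and> e < 3}"

fun Kmul :: "nat \<Rightarrow> int \<Rightarrow> kel \<Rightarrow> kel \<Rightarrow> kel" where
  "Kmul n r (x1, y1, z1, e1) (x2, y2, z2, e2) =
     ((x1 + r ^ (2 * e1) * x2) mod int n, (y1 + r ^ (2 * e1) * y2) mod int n,
      (z1 + r ^ (2 * e1) * z2) mod int n, (e1 + e2) mod 3)"

definition Ka :: kel where "Ka = (1, 0, 0, 0)"
definition Kb :: kel where "Kb = (0, 1, 0, 0)"
definition Kc :: kel where "Kc = (0, 0, 1, 0)"
definition Kh :: kel where "Kh = (0, 0, 0, 1)"
definition Khinv :: kel where "Khinv = (0, 0, 0, 2)"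

datatype sym = Su | Sv | Sw | Sx | Sy | Sz

definition NCG_V :: "nat \<Rightarrow> (sym \<times> kel) set" where
  "NCG_V n = UNIV \<times> Kcarrier n"

definition NCG_E :: "nat \<Rightarrow> int \<Rightarrow> ((sym \<times> kel) \<times> (sym \<times> kel)) set" where
  "NCG_E n r = (\<Union>g\<in>Kcarrier n.
     { ((Su, g), (Sx, g)), ((Su, g), (Sy, g)), ((Su, g), (Sz, g)),
       ((Sv, g), (Sx, Kmul n r (Kmul n r g Khinv) Kb)), ((Sv, g), (Sy, g)), ((Sv, g), (Sz, Kmul n r g Kh)),
       ((Sw, g), (Sx, Kmul n r (Kmul n r g Khinv) Ka)), ((Sw, g), (Sy, Kmul n r (Kmul n r g Kh) Kc)),
       ((Sw, g), (Sz, g)) })"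

definition NCG_adj :: "nat \<Rightarrow> int \<Rightarrow> sym \<times> kel \<Rightarrow> sym \<times> kel \<Rightarrow> bool" where
  "NCG_adj n r p q \<longleftrightarrow> (p, q) \<in> NCG_E n r \<or> (q, p) \<in> NCG_E n r"

end

theory Submission
  imports Defs
begin

text \<open>
  The graph is the \<open>K\<close>-cover of \<open>K\<^sub>3\<^sub>,\<^sub>3\<close> given by a voltage assignment. Its girth is 12 and the 12-cycles are the lifts
  of 4-cycles traversed three times, so every automorphism permutes the fibres over the six symbols and projects
  to \<open>K\<^sub>3\<^sub>,\<^sub>3\<close>. A group of order 36, isomorphic to \<open>\<int>\<^sub>3\<^sup>2 : \<int>\<^sub>4\<close>, lifts, which gives regularity on 2-arcs as soon as an
  automorphism fixing a 2-arc is trivial; the only other possible projection would exchange \<open>r\<close> with \<open>r\<^sup>2\<close>.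
  So \<open>Aut\<close> is an extension of \<open>K\<close> by \<open>\<int>\<^sub>3\<^sup>2 : \<int>\<^sub>4\<close> and is solvable. The elements that swap the two parts map to
  generators of \<open>\<int>\<^sub>4\<close>: none of them is an involution, and a subgroup acting regularly on the vertices, which contains
  such an element, would have order divisible by 4, whereas \<open>18 n\<^sup>3\<close> is not because \<open>n\<close> is odd.
\<close>

section \<open>Eisenstein coordinates for the voltages\<close>

text \<open>A pair \<open>(a, b)\<close> stands for \<open>a + b\<omega>\<close> with \<open>\<omega>\<^sup>2 + \<omega> + 1 = 0\<close>; the group on \<open>kE\<close> is the
  characteristic-zero analogue of \<open>K\<close>, which it covers via \<open>\<omega> \<mapsto> r\<close>. All voltage computations take place there,
  independently of \<open>n\<close>.\<close>

type_synonym eis = "int \<times> int"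
type_synonym kE = "eis \<times> eis \<times> eis \<times> nat"

fun addE :: "eis \<Rightarrow> eis \<Rightarrow> eis" where
  "addE (a, b) (c, d) = (a + c, b + d)"

fun negE :: "eis \<Rightarrow> eis" where
  "negE (a, b) = (- a, - b)"

text \<open>Multiplication by \<open>\<omega> ^ (2 * e)\<close>, for \<open>e < 3\<close>.\<close>

fun rot :: "nat \<Rightarrow> eis \<Rightarrow> eis" where
  "rot e (a, b) = (if e = 0 then (a, b) else if e = 1 then (b - a, - a) else (- b, a - b))"

fun normE :: "eis \<Rightarrow> int" where
  "normE (a, b) = a * a - a * b + b * b"

fun mulE :: "kE \<Rightarrow> kE \<Rightarrow> kE" where
  "mulE (v1, v2, v3, e) (w1, w2, w3, f) =
     (addE v1 (rot e w1), addE v2 (rot e w2), addE v3 (rot e w3), (e + f) mod 3)"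

definition oneE :: kE where "oneE = ((0, 0), (0, 0), (0, 0), 0)"

fun invE :: "kE \<Rightarrow> kE" where
  "invE (v1, v2, v3, e) = (let f = (3 - e) mod 3 in
     (negE (rot f v1), negE (rot f v2), negE (rot f v3), f))"

fun ang :: "kE \<Rightarrow> nat" where
  "ang (v1, v2, v3, e) = e"

lemma less3_cases: "(e::nat) < 3 \<Longrightarrow> (e = 0 \<Longrightarrow> P) \<Longrightarrow> (e = 1 \<Longrightarrow> P) \<Longrightarrow> (e = 2 \<Longrightarrow> P) \<Longrightarrow> P"
  by linarith

lemma ang_mulE [simp]: "ang (mulE g h) = (ang g + ang h) mod 3"
  by (cases g; cases h) auto

lemma ang_oneE [simp]: "ang oneE = 0"
  by (simp add: oneE_def)

lemma ang_invE: "ang (invE g) < 3"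
  by (cases g) (auto simp: Let_def)

lemma mulE_assoc:
  assumes "ang g < 3" "ang h < 3"
  shows "mulE (mulE g h) k = mulE g (mulE h k)"
proof -
  obtain x1 x2 x3 x4 x5 x6 e where g: "g = ((x1,x2),(x3,x4),(x5,x6),e)"
    by (metis prod.exhaust)
  obtain y1 y2 y3 y4 y5 y6 f where h: "h = ((y1,y2),(y3,y4),(y5,y6),f)"
    by (metis prod.exhaust)
  obtain z1 z2 z3 z4 z5 z6 d where k: "k = ((z1,z2),(z3,z4),(z5,z6),d)"
    by (metis prod.exhaust)
  have "e < 3" "f < 3"
    using assms g h by auto
  then show ?thesis
    by (elim less3_cases; auto simp: g h k mod_simps algebra_simps; presburger)
qed

lemma mulE_oneE [simp]: "ang g < 3 \<Longrightarrow> mulE g oneE = g" "ang g < 3 \<Longrightarrow> mulE oneE g = g"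
  by (cases g; auto simp: oneE_def)+

lemma mulE_invE:
  assumes "ang g < 3"
  shows "mulE g (invE g) = oneE" "mulE (invE g) g = oneE"
proof -
  obtain x1 x2 x3 x4 x5 x6 e where g: "g = ((x1,x2),(x3,x4),(x5,x6),e)"
    by (metis prod.exhaust)
  have "e < 3"
    using assms g by auto
  then show "mulE g (invE g) = oneE" "mulE (invE g) g = oneE"
    by (elim less3_cases; auto simp: g oneE_def Let_def)+
qed

section \<open>Voltages on the complete bipartite graph\<close>

fun isU :: "sym \<Rightarrow> bool" where
  "isU Su = True" | "isU Sv = True" | "isU Sw = True"
| "isU Sx = False" | "isU Sy = False" | "isU Sz = False"

definition opposite :: "sym \<Rightarrow> sym \<Rightarrow> bool" where
  "opposite s t \<longleftrightarrow> isU s \<noteq> isU t"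

text \<open>Right multiplication convention: the edge \<open>(s, g) - (t, g * volt s t)\<close> lies over \<open>s - t\<close>.\<close>

fun voltU :: "sym \<Rightarrow> sym \<Rightarrow> kE" where
  "voltU Sv Sx = ((0, 0), (0, 1), (0, 0), 2)"
| "voltU Sv Sz = ((0, 0), (0, 0), (0, 0), 1)"
| "voltU Sw Sx = ((0, 1), (0, 0), (0, 0), 2)"
| "voltU Sw Sy = ((0, 0), (0, 0), (-1, -1), 1)"
| "voltU s t = oneE"

definition volt :: "sym \<Rightarrow> sym \<Rightarrow> kE" where
  "volt s t = (if isU s then voltU s t else invE (voltU t s))"

lemma ang_voltU: "ang (voltU s t) < 3"
  by (cases s; cases t; simp add: oneE_def)

lemma ang_volt [simp]: "ang (volt s t) < 3"
  by (simp add: volt_def ang_voltU ang_invE)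

lemma opposite_sym: "opposite s t \<longleftrightarrow> opposite t s"
  by (auto simp: opposite_def)

lemma volt_inverse: "opposite s t \<Longrightarrow> mulE (volt s t) (volt t s) = oneE"
  by (auto simp: volt_def opposite_def mulE_invE ang_voltU)

section \<open>The symbol permutations that lift\<close>

text \<open>A permutation of the symbols is the list of its values on \<open>u, v, w, x, y, z\<close>.\<close>

definition all_syms :: "sym list" where "all_syms = [Su, Sv, Sw, Sx, Sy, Sz]"

fun idx :: "sym \<Rightarrow> nat" where
  "idx Su = 0" | "idx Sv = 1" | "idx Sw = 2" | "idx Sx = 3" | "idx Sy = 4" | "idx Sz = 5"

definition app_perm :: "sym list \<Rightarrow> sym \<Rightarrow> sym" where
  "app_perm l s = l ! idx s"

definition comp_perm :: "sym list \<Rightarrow> sym list \<Rightarrow> sym list" where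
  "comp_perm l m = map (app_perm l) m"

definition gen1 :: "sym list" where "gen1 = [Sz, Sy, Sx, Sw, Su, Sv]"
definition gen2 :: "sym list" where "gen2 = [Sz, Sy, Sx, Sv, Sw, Su]"

fun eval_word :: "bool list \<Rightarrow> sym list" where
  "eval_word [] = all_syms"
| "eval_word (b # w) = comp_perm (if b then gen2 else gen1) (eval_word w)"

lemma idx_less: "idx s < 6"
  by (cases s) auto

lemma length_eval_word [simp]: "length (eval_word w) = 6"
  by (induction w) (auto simp: all_syms_def comp_perm_def)

lemma app_comp_perm: "length m = 6 \<Longrightarrow> app_perm (comp_perm l m) s = app_perm l (app_perm m s)"
  by (simp add: app_perm_def comp_perm_def idx_less)

lemma app_all_syms [simp]: "app_perm all_syms s = s"
  by (cases s) (auto simp: app_perm_def all_syms_def)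

text \<open>One word in the two generators for each entry of \<open>perm_table\<close>, in the same
  order. Facts about all 36 permutations thereby reduce to inductions over words.\<close>

definition perm_words :: "bool list list" where
  "perm_words = [[], [False], [True], [False, False], [True, False], [False, True], [True, True],
    [False, False, False], [True, False, False], [False, True, False], [True, True, False], [False,
    False, True], [False, True, True], [True, False, False, False], [False, True, False, False],
    [True, True, False, False], [False, False, True, False], [False, True, True, False], [False,
    False, False, True], [True, False, False, True], [False, False, True, True], [False, True,
    False, False, False], [True, True, False, False, False], [False, False, True, False, False],
    [False, True, True, False, False], [False, False, False, True, False], [True, False, False,
    True, False], [False, False, True, True, False], [False, False, True, False, False, False],
    [False, True, True, False, False, False], [False, False, False, True, False, False], [True,
    False, False, True, False, False], [False, False, True, True, False, False], [False, False,
    False, True, False, False, False], [True, False, False, True, False, False, False], [False,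
    False, True, True, False, False, False]]"

text \<open>The group of the 36 liftable automorphisms of \<open>K\<^sub>3\<^sub>,\<^sub>3\<close> is \<open>\<int>\<^sub>3\<^sup>2 : \<int>\<^sub>4\<close>; the second component is the projection to \<open>\<int>\<^sub>4\<close>,
  which sends both generators to 1 and is odd exactly on the permutations that swap the two parts.\<close>

definition perm_table :: "(sym list \<times> nat) list" where
  "perm_table = [
    ([Su, Sv, Sw, Sx, Sy, Sz], 0),
    ([Sz, Sy, Sx, Sw, Su, Sv], 1),
    ([Sz, Sy, Sx, Sv, Sw, Su], 1),
    ([Sv, Su, Sw, Sx, Sz, Sy], 2),
    ([Su, Sw, Sv, Sx, Sz, Sy], 2),
    ([Sv, Su, Sw, Sy, Sx, Sz], 2),
    ([Su, Sw, Sv, Sy, Sx, Sz], 2),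
    ([Sy, Sz, Sx, Sw, Sv, Su], 3),
    ([Sy, Sz, Sx, Sv, Su, Sw], 3),
    ([Sz, Sx, Sy, Sw, Sv, Su], 3),
    ([Sz, Sx, Sy, Sv, Su, Sw], 3),
    ([Sy, Sz, Sx, Su, Sw, Sv], 3),
    ([Sz, Sx, Sy, Su, Sw, Sv], 3),
    ([Sw, Su, Sv, Sx, Sy, Sz], 0),
    ([Su, Sv, Sw, Sy, Sz, Sx], 0),
    ([Sw, Su, Sv, Sy, Sz, Sx], 0),
    ([Sv, Sw, Su, Sx, Sy, Sz], 0),
    ([Sv, Sw, Su, Sy, Sz, Sx], 0),
    ([Su, Sv, Sw, Sz, Sx, Sy], 0),
    ([Sw, Su, Sv, Sz, Sx, Sy], 0),
    ([Sv, Sw, Su, Sz, Sx, Sy], 0),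
    ([Sx, Sz, Sy, Sw, Su, Sv], 1),
    ([Sx, Sz, Sy, Sv, Sw, Su], 1),
    ([Sz, Sy, Sx, Su, Sv, Sw], 1),
    ([Sx, Sz, Sy, Su, Sv, Sw], 1),
    ([Sy, Sx, Sz, Sw, Su, Sv], 1),
    ([Sy, Sx, Sz, Sv, Sw, Su], 1),
    ([Sy, Sx, Sz, Su, Sv, Sw], 1),
    ([Sw, Sv, Su, Sx, Sz, Sy], 2),
    ([Sw, Sv, Su, Sy, Sx, Sz], 2),
    ([Sv, Su, Sw, Sz, Sy, Sx], 2),
    ([Su, Sw, Sv, Sz, Sy, Sx], 2),
    ([Sw, Sv, Su, Sz, Sy, Sx], 2),
    ([Sx, Sy, Sz, Sw, Sv, Su], 3),
    ([Sx, Sy, Sz, Sv, Su, Sw], 3),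
    ([Sx, Sy, Sz, Su, Sw, Sv], 3)]"

definition perms :: "sym list list" where "perms = map fst perm_table"

definition chi :: "sym list \<Rightarrow> nat" where "chi l = the (map_of perm_table l)"

lemma perms_eq_words: "perms = map eval_word perm_words"
  by code_simp

text \<open>Closure is tabulated for left multiplication by the generators only;
  \<open>eval_word_comp\<close> extends it to all pairs by induction over words.\<close>

lemma perms_gen: "list_all (\<lambda>m. list_all (\<lambda>g. comp_perm g m \<in> set perms \<and> chi (comp_perm g m) = (chi m + 1) mod 4) [gen1, gen2]) perms"
  by code_simp

lemma perms_inverse_table: "list_all (\<lambda>l. list_ex (\<lambda>m. comp_perm l m = all_syms \<and> comp_perm m l = all_syms) perms) perms"
  by code_simp

lemma perms_opposite_table: "list_all (\<lambda>l. list_all (\<lambda>s. list_all (\<lambda>t. opposite (app_perm l s) (app_perm l t) = opposite s t \<and> (app_perm l s = app_perm l t \<longrightarrow> s = t)) all_syms) all_syms) perms"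
  by code_simp

lemma perms_odd_table: "list_all (\<lambda>l. list_all (\<lambda>s. opposite s (app_perm l s) = odd (chi l)) all_syms) perms"
  by code_simp

text \<open>The kernel of \<open>chi\<close> is the abelian group that rotates
  \<open>u, v, w\<close> and \<open>x, y, z\<close> independently; this serves the solvability
  proof.\<close>

lemma perms_even_commute: "list_all (\<lambda>l. list_all (\<lambda>m. chi l = 0 \<and> chi m = 0 \<longrightarrow> comp_perm l m = comp_perm m l) perms) perms"
  by code_simp

text \<open>The 2-arc \<open>x, u, y\<close> of \<open>K\<^sub>3\<^sub>,\<^sub>3\<close> becomes the
  reference from which all later cycle computations start.\<close>

lemma perms_transitive_table: "list_all (\<lambda>s. list_all (\<lambda>t. list_all (\<lambda>q. opposite s t \<and> opposite t q \<and> s \<noteq> q \<longrightarrow>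
   list_ex (\<lambda>l. app_perm l s = Sx \<and> app_perm l t = Su \<and> app_perm l q = Sy) perms) all_syms) all_syms) all_syms"
  by code_simp

section \<open>Twelve-cycles\<close>

text \<open>If \<open>a + b r\<close> vanishes modulo \<open>n\<close> then \<open>n\<close> divides the norm of \<open>a + b\<omega>\<close>. The voltages to be kept
  away from 1 have a nonzero exponent of \<open>h\<close> or a coordinate of positive norm less than 7; this is where \<open>n \<ge> 7\<close> is needed.\<close>

fun small :: "eis \<Rightarrow> bool" where
  "small p \<longleftrightarrow> (let k = normE p in 0 < k \<and> k < 7)"

fun nontrivial :: "kE \<Rightarrow> bool" where
  "nontrivial (v1, v2, v3, e) \<longleftrightarrow> e \<noteq> 0 \<or> small v1 \<or> small v2 \<or> small v3"

fun walkE :: "kE \<Rightarrow> sym \<Rightarrow> sym list \<Rightarrow> kE" where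
  "walkE g s [] = g"
| "walkE g s (t # ts) = walkE (mulE g (volt s t)) t ts"

definition nbrs :: "sym \<Rightarrow> sym list" where
  "nbrs s = (if isU s then [Sx, Sy, Sz] else [Su, Sv, Sw])"

lemma set_nbrs [simp]: "set (nbrs s) = {t. opposite s t}"
  by (cases s) (auto simp: nbrs_def opposite_def, (metis isU.simps sym.exhaust)+)

text \<open>No continuation by \<open>k\<close> non-backtracking steps of a walk that arrived from \<open>p\<close> at \<open>c\<close>, with total voltage \<open>g\<close>,
  closes up at the starting point \<open>(x, 1)\<close>. The conditionals (rather than implications) keep \<open>code_simp\<close> from
  exploring backtracking branches.\<close>

fun no_return :: "nat \<Rightarrow> sym \<Rightarrow> sym \<Rightarrow> kE \<Rightarrow> bool" where
  "no_return 0 p c g = (if c = Sx then nontrivial g else True)"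
| "no_return (Suc k) p c g = list_all (\<lambda>q. if q = p then True else no_return k c q (mulE g (volt c q))) (nbrs c)"

text \<open>For any two of \<open>u, v, w\<close> the exponents of \<open>h\<close> towards
  \<open>x, y, z\<close> differ by three distinct values modulo 3. So the voltage of a 4-cycle has a
  nonzero exponent \<open>e\<close> of \<open>h\<close>, and it cubes to 1 because 1 + \<omega>^(2e)
  + \<omega>^(4e) = 0.\<close>

lemma four_cycle_cubed:
  "list_all (\<lambda>a. list_all (\<lambda>b. list_all (\<lambda>c. list_all (\<lambda>d.
     if a = c \<or> b = d then True else
     walkE oneE a [b, c, d, a, b, c, d, a, b, c, d, a] = oneE) (nbrs c)) (nbrs b)) (nbrs a)) all_syms"
  by code_simp

text \<open>Four steps starting along \<open>x, u, y\<close> either return to the symbol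
  \<open>x\<close>, which is the case of a lifted 4-cycle, or lead to walks for which eight further
  steps never close up.\<close>

lemma no_other_12_cycle: "list_all (\<lambda>d. list_all (\<lambda>e. if d = Su \<or> e = Sy \<or> e = Sx then True else
     no_return 8 d e (walkE oneE Sx [Su, Sy, d, e])) (nbrs d)) (nbrs Sy)"
  by code_simp

section \<open>Two explicit lifts\<close>

text \<open>\<open>phi1\<close> and \<open>phi2\<close> are the automorphisms of the group \<open>kE\<close> induced by \<open>gen1\<close> and \<open>gen2\<close> on the voltages of closed walks
  at \<open>u\<close>; the lift maps \<open>(s, g)\<close> to \<open>(gen s, phi g * corr s)\<close>.\<close>

fun phi1 :: "kE \<Rightarrow> kE" where
  "phi1 (x, y, z, e) = (negE (rot 2 x), addE (rot 2 x) z, negE (rot 1 y), e)"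

fun corr1 :: "sym \<Rightarrow> kE" where
  "corr1 Sz = ((0, 0), (0, 0), (0, 0), 2)"
| "corr1 Sw = ((0, 0), (-1, -1), (0, 0), 1)"
| "corr1 _ = oneE"

fun phi2 :: "kE \<Rightarrow> kE" where
  "phi2 (x, y, z, e) = (negE (rot 2 z), negE (rot 1 x),
     addE (addE (rot 1 x) (negE (addE y z))) (if e = 0 then (0, 0) else if e = 1 then (-1, -1) else (-1, 0)), e)"

fun corr2 :: "sym \<Rightarrow> kE" where
  "corr2 Sx = ((0, 0), (0, 0), (0, 0), 2)"
| "corr2 Sv = ((0, 0), (0, 0), (-1, -1), 1)"
| "corr2 _ = oneE"

text \<open>Compatibility of the lift with crossing the edge over \<open>s - t\<close>. Both sides
  are affine in the coordinates of \<open>g\<close>, so the split over edges and exponents leaves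
  linear identities.\<close>

lemma lift1_step:
  assumes "opposite s t" "ang g < 3"
  shows "mulE (phi1 (mulE g (volt s t))) (corr1 t) =
         mulE (mulE (phi1 g) (corr1 s)) (volt (app_perm gen1 s) (app_perm gen1 t))"
proof -
  obtain x1 x2 x3 x4 x5 x6 e where g: "g = ((x1,x2),(x3,x4),(x5,x6),e)"
    by (metis prod.exhaust)
  have "e < 3"
    using assms g by auto
  then show ?thesis using assms(1)
    by (elim less3_cases; cases s; cases t; simp add: g opposite_def volt_def oneE_def Let_def app_perm_def gen1_def)
qed

text \<open>\<open>phi2\<close> sends \<open>h\<close> to \<open>c\<close> to the power \<omega>^2
  times \<open>h\<close>. Its last summand is the corresponding 1-cocycle of the cyclic group of
  order 3, with value \<omega>^2 at 1 and \<omega>^2 + \<omega>^4 = -1 at 2.\<close>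

lemma lift2_step:
  assumes "opposite s t" "ang g < 3"
  shows "mulE (phi2 (mulE g (volt s t))) (corr2 t) =
         mulE (mulE (phi2 g) (corr2 s)) (volt (app_perm gen2 s) (app_perm gen2 t))"
proof -
  obtain x1 x2 x3 x4 x5 x6 e where g: "g = ((x1,x2),(x3,x4),(x5,x6),e)"
    by (metis prod.exhaust)
  have "e < 3"
    using assms g by auto
  then show ?thesis using assms(1)
    by (elim less3_cases; cases s; cases t; simp add: g opposite_def volt_def oneE_def Let_def app_perm_def gen2_def)
qed

lemma ang_walkE [simp]: "ang g < 3 \<Longrightarrow> ang (walkE g s ts) < 3"
  by (induction ts arbitrary: g s) auto

lemma walkE_mulE: "ang g < 3 \<Longrightarrow> ang h < 3 \<Longrightarrow> walkE (mulE g h) s ts = mulE g (walkE h s ts)"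
  by (induction ts arbitrary: h s) (auto simp: mulE_assoc)

lemma walkE_base: "ang g < 3 \<Longrightarrow> walkE g s ts = mulE g (walkE oneE s ts)"
  using walkE_mulE[of g oneE s ts] by simp

fun alternating :: "sym \<Rightarrow> sym list \<Rightarrow> bool" where
  "alternating s [] = True"
| "alternating s (t # ts) \<longleftrightarrow> opposite s t \<and> alternating t ts"

section \<open>The graph as a voltage cover\<close>

locale ncg =
  fixes n :: nat and r :: int
  assumes n7: "n \<ge> 7" and r_root: "(r ^ 2 + r + 1) mod int n = 0"
begin

definition val :: "eis \<Rightarrow> int" where
  "val p = (fst p + snd p * r) mod int n"

fun ev :: "kE \<Rightarrow> kel" where
  "ev (v1, v2, v3, e) = (val v1, val v2, val v3, e)"

abbreviation K where "K \<equiv> Kcarrier n"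
abbreviation mul where "mul \<equiv> Kmul n r"
abbreviation V where "V \<equiv> NCG_V n"
abbreviation adj where "adj \<equiv> NCG_adj n r"

lemma root_dvd: "int n dvd (r ^ 2 + r + 1) * k"
  using r_root by auto

lemma mod_eqI: "a - b = (r ^ 2 + r + 1) * k \<Longrightarrow> a mod int n = b mod int n"
  using root_dvd by (simp add: mod_eq_dvd_iff)

lemma val_add: "val (addE p q) = (val p + val q) mod int n"
  by (cases p; cases q) (simp add: val_def mod_simps, simp add: algebra_simps)

lemma val_neg: "val (negE p) = (- val p) mod int n"
  by (cases p) (simp add: val_def mod_simps algebra_simps)

lemma val_rot: "e < 3 \<Longrightarrow> val (rot e p) = (r ^ (2 * e) * val p) mod int n"
proof (elim less3_cases)
  obtain a b where p: "p = (a, b)" by force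
  show "val (rot e p) = (r ^ (2 * e) * val p) mod int n" if "e = 0"
    using that by (simp add: p val_def)
  show "val (rot e p) = (r ^ (2 * e) * val p) mod int n" if "e = 1"
  proof -
    have "(r ^ 2 * (a + b * r)) mod int n = (b - a - a * r) mod int n"
      \<comment> \<open>The quotient comes from
        \<open>r ^ 3 - 1 = (r - 1) * (r ^ 2 + r + 1)\<close>.\<close>
      by (rule mod_eqI[where k = "a + b * (r - 1)"]) algebra
    then show ?thesis
      using that by (simp add: p val_def mod_simps)
  qed
  show "val (rot e p) = (r ^ (2 * e) * val p) mod int n" if "e = 2"
  proof -
    have "(r ^ 4 * (a + b * r)) mod int n = (- b + (a - b) * r) mod int n"
      \<comment> \<open>Here \<open>r ^ 4 - r\<close> and \<open>r ^ 5 + r + 1\<close> are divided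
        by \<open>r ^ 2 + r + 1\<close>.\<close>
      by (rule mod_eqI[where k = "a * r * (r - 1) + b * (r ^ 3 - r ^ 2 + 1)"]) algebra
    then show ?thesis
      using that by (simp add: p val_def mod_simps)
  qed
qed

lemma ev_mulE: "ang g < 3 \<Longrightarrow> ev (mulE g h) = mul (ev g) (ev h)"
  by (cases g; cases h) (simp add: val_add val_rot mod_simps)

lemma val_norm:
  assumes "val (a, b) = 0"
  shows "int n dvd normE (a, b)"
proof -
  have "int n dvd a + b * r"
    using assms by (simp add: val_def mod_eq_0_iff_dvd)
  \<comment> \<open>The second factor is the value at \<open>r\<close> of the conjugate a + b
    \<omega>^2, so the product is the norm up to a multiple of \<open>r ^ 2 + r + 1\<close>.\<close>
  then have "int n dvd (a + b * r) * (a - b - b * r) + (r ^ 2 + r + 1) * (b * b)"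
    using root_dvd by (intro dvd_add) auto
  also have "(a + b * r) * (a - b - b * r) + (r ^ 2 + r + 1) * (b * b) = normE (a, b)"
    by (simp, algebra)
  finally show ?thesis .
qed

lemma val_small: "small p \<Longrightarrow> val p \<noteq> 0"
  using val_norm n7 zdvd_not_zless by (cases p) (fastforce simp: Let_def)

definition oneK where "oneK = ev oneE"

lemma oneK_eq: "oneK = (0, 0, 0, 0)"
  by (simp add: oneK_def oneE_def val_def)

lemma ev_nontrivial: "nontrivial g \<Longrightarrow> ev g \<noteq> oneK"
  using val_small by (cases g) (auto simp: oneK_eq simp del: small.simps)

lemma ev_in_K: "ang g < 3 \<Longrightarrow> ev g \<in> K"
  using n7 by (cases g) (auto simp: Kcarrier_def val_def)

fun lift :: "kel \<Rightarrow> kE" where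
  "lift (x, y, z, e) = ((x, 0), (y, 0), (z, 0), e)"

lemma ev_lift [simp]: "k \<in> K \<Longrightarrow> ev (lift k) = k"
  by (cases k) (auto simp: Kcarrier_def val_def)

lemma ang_lift [simp]: "k \<in> K \<Longrightarrow> ang (lift k) < 3"
  by (cases k) (auto simp: Kcarrier_def)

text \<open>\<open>ev\<close> is onto, so the group laws of \<open>K\<close> are inherited from
  \<open>kE\<close>. The section \<open>lift\<close> supplies preimages but is not a
  homomorphism.\<close>

lemma in_K_E: "k \<in> K \<Longrightarrow> (\<And>g. ang g < 3 \<Longrightarrow> k = ev g \<Longrightarrow> P) \<Longrightarrow> P"
  by (metis ev_lift ang_lift)

lemma mul_closed [simp]: "g \<in> K \<Longrightarrow> h \<in> K \<Longrightarrow> mul g h \<in> K"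
  by (elim in_K_E) (simp add: ev_in_K flip: ev_mulE)

lemma mul_assoc: "g \<in> K \<Longrightarrow> h \<in> K \<Longrightarrow> k \<in> K \<Longrightarrow> mul (mul g h) k = mul g (mul h k)"
  by (elim in_K_E) (simp add: mulE_assoc flip: ev_mulE)

lemma oneK_closed [simp]: "oneK \<in> K"
  by (simp add: oneK_def ev_in_K)

lemma mul_oneK [simp]: "g \<in> K \<Longrightarrow> mul g oneK = g" "g \<in> K \<Longrightarrow> mul oneK g = g"
  by (elim in_K_E; simp add: oneK_def flip: ev_mulE)+

lemma inverse_ex:
  assumes "g \<in> K" obtains h where "h \<in> K" "mul g h = oneK" "mul h g = oneK"
proof -
  obtain g' where g': "ang g' < 3" "g = ev g'" using assms by (elim in_K_E)
  show thesis
    by (rule that[of "ev (invE g')"]) (simp_all add: oneK_def ev_in_K ang_invE mulE_invE g' flip: ev_mulE)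
qed

text \<open>The neighbour of \<open>x\<close> in the fibre over \<open>q\<close>, for
  \<open>q\<close> in the other part. Symbols thus label the edges at a vertex, and a walk is a
  starting vertex with a list of symbols.\<close>

definition N :: "sym \<Rightarrow> sym \<times> kel \<Rightarrow> sym \<times> kel" where
  "N q x = (q, mul (snd x) (ev (volt (fst x) q)))"

lemma fst_N [simp]: "fst (N q x) = q"
  by (simp add: N_def)

lemma in_V: "x \<in> V \<longleftrightarrow> snd x \<in> K"
  by (cases x) (simp add: NCG_V_def)

lemma N_closed [simp]: "x \<in> V \<Longrightarrow> N q x \<in> V"
  by (simp add: in_V N_def ev_in_K)

lemma N_N [simp]: "x \<in> V \<Longrightarrow> opposite (fst x) q \<Longrightarrow> N (fst x) (N q x) = x"
  by (cases x) (simp add: N_def in_V mul_assoc ev_in_K volt_inverse oneK_def[symmetric] flip: ev_mulE)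

lemma K_generators: "Ka = ev ((1, 0), (0, 0), (0, 0), 0)" "Kb = ev ((0, 0), (1, 0), (0, 0), 0)"
   "Kc = ev ((0, 0), (0, 0), (1, 0), 0)" "Kh = ev ((0, 0), (0, 0), (0, 0), 1)"
   "Khinv = ev ((0, 0), (0, 0), (0, 0), 2)"
  using n7 by (simp_all add: Ka_def Kb_def Kc_def Kh_def Khinv_def val_def)

lemma edge_iff:
  "((s, g), (q, h)) \<in> NCG_E n r \<longleftrightarrow> isU s \<and> \<not> isU q \<and> g \<in> K \<and> h = mul g (ev (volt s q))"
proof (cases "g \<in> K")
  case True
  then obtain g' where g': "ang g' < 3" "g = ev g'" by (elim in_K_E)
  \<comment> \<open>Moving the power of \<open>h\<close> to the right multiplies exponents by
    \<omega> for \<open>Khinv\<close> and by \<omega>^2 = -1 - \<omega> for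
    \<open>Kh\<close>.\<close>
  have 1: "mul (mul g Khinv) Kb = mul g (ev ((0, 0), (0, 1), (0, 0), 2))"
    "mul (mul g Khinv) Ka = mul g (ev ((0, 1), (0, 0), (0, 0), 2))"
    "mul (mul g Kh) Kc = mul g (ev ((0, 0), (0, 0), (-1, -1), Suc 0))"
    by (simp_all add: K_generators g' mulE_assoc del: ev.simps flip: ev_mulE)
  have 2: "mul g (ev oneE) = g" "ev ((0, 0), (0, 0), (0, 0), Suc 0) = Kh"
    using True by (simp_all add: K_generators flip: oneK_def)
  show ?thesis
    using True by (cases s; cases q) (auto simp: NCG_E_def volt_def 1 2 simp del: ev.simps)
next
  case False
  then show ?thesis by (auto simp: NCG_E_def)
qed

lemma adj_iff:
  assumes "x \<in> V" "y \<in> V"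
  shows "adj x y \<longleftrightarrow> opposite (fst x) (fst y) \<and> y = N (fst y) x"
proof -
  have e: "(x, y) \<in> NCG_E n r \<longleftrightarrow> isU (fst x) \<and> \<not> isU (fst y) \<and> y = N (fst y) x"
    if "x \<in> V" "y \<in> V" for x y
    using that edge_iff[of "fst x" "snd x" "fst y" "snd y"]
    by (cases x; cases y) (auto simp: in_V N_def)
  have "x = N (fst x) y \<longleftrightarrow> y = N (fst y) x" if "opposite (fst x) (fst y)"
    using N_N assms that opposite_sym by metis
  then show ?thesis
    unfolding NCG_adj_def using e[OF assms] e[OF assms(2,1)] by (auto simp: opposite_def)
qed

lemma adj_N: "x \<in> V \<Longrightarrow> opposite (fst x) q \<Longrightarrow> adj x (N q x)"
  by (simp add: adj_iff)

lemma adj_sym: "adj x y \<longleftrightarrow> adj y x"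
  by (auto simp: NCG_adj_def)

lemma adjE:
  assumes "adj x y" "x \<in> V" "y \<in> V"
  obtains q where "opposite (fst x) q" "y = N q x"
  using assms adj_iff by blast

fun walk :: "sym \<times> kel \<Rightarrow> sym list \<Rightarrow> sym \<times> kel" where
  "walk x [] = x"
| "walk x (t # ts) = walk (N t x) ts"

lemma walk_ev: "ang g < 3 \<Longrightarrow> walk (s, ev g) ts = (last (s # ts), ev (walkE g s ts))"
  by (induction ts arbitrary: g s) (auto simp: N_def simp flip: ev_mulE)

lemma walk_mul: "k \<in> K \<Longrightarrow> walk (s, k) ts = (last (s # ts), mul k (ev (walkE oneE s ts)))"
  using walk_ev[of "lift k" s ts] walkE_base[of "lift k" s ts] ev_mulE[of "lift k" "walkE oneE s ts"]
  by simp

section \<open>Connectedness, from loops at \<open>Su\<close> whose voltages are the generators of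
  \<open>K\<close>\<close>

lemma loop_a: "walkE oneE Su [Sy, Sv, Sz, Sw, Sx, Su] = ((1, 0), (0, 0), (0, 0), 0)"
  and loop_b: "walkE oneE Su [Sy, Sv, Sz, Su, Sy, Sv, Sx, Su] = ((0, 0), (1, 0), (0, 0), 0)"
  and loop_c: "walkE oneE Su [Sz, Sv, Sy, Su, Sz, Sw, Sy, Su] = ((0, 0), (0, 0), (1, 0), 0)"
  and loop_h: "walkE oneE Su [Sy, Sv, Sz, Su] = ((0, 0), (0, 0), (0, 0), 1)"
  by code_simp+

context
  fixes P :: "sym \<times> kel \<Rightarrow> bool"
  assumes step: "\<And>x q. x \<in> V \<Longrightarrow> opposite (fst x) q \<Longrightarrow> P x \<Longrightarrow> P (N q x)"
begin

text \<open>Edges can be traversed back, so a property inherited by neighbours is constant along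
  walks. This turns connectedness into the induction rule \<open>connected_induct\<close>.\<close>

lemma step_iff: "x \<in> V \<Longrightarrow> opposite (fst x) q \<Longrightarrow> P (N q x) \<longleftrightarrow> P x"
  by (metis step N_N N_closed fst_N opposite_sym)

lemma walk_iff: "x \<in> V \<Longrightarrow> alternating (fst x) ts \<Longrightarrow> P (walk x ts) \<longleftrightarrow> P x"
  by (induction ts arbitrary: x) (auto simp: step_iff)

lemma loop_iff:
  assumes "walkE oneE Su ts = g" "alternating Su ts" "last (Su # ts) = Su" "ang h < 3"
  shows "P (Su, ev (mulE h g)) \<longleftrightarrow> P (Su, ev h)"
  using walk_iff[of "(Su, ev h)" ts] walk_mul[of "ev h" Su ts] assms
  by (simp add: in_V ev_in_K ev_mulE)

lemma base_iff:
  assumes "k \<in> K" shows "P (Su, k) \<longleftrightarrow> P (Su, oneK)"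
proof -
  obtain x y z e where k: "k = (int x, int y, int z, e)" "e < 3"
    using assms by (cases k) (auto simp: Kcarrier_def dest!: zero_le_imp_eq_int)
  \<comment> \<open>The element \<open>k\<close> is built up one generator at a time, in the order
    \<open>a\<close>, \<open>b\<close>, \<open>c\<close>, \<open>h\<close>. Exponents of
    \<open>a\<close>, \<open>b\<close>, \<open>c\<close> stay unreduced in \<open>kE\<close>, so
    nothing wraps around modulo \<open>n\<close>.\<close>
  have a: "P (Su, ev ((int x, 0), (0, 0), (0, 0), 0)) \<longleftrightarrow> P (Su, oneK)" for x
  proof (induction x)
    case 0 then show ?case by (simp add: oneK_def oneE_def)
  next
    case (Suc x)
    have "mulE ((int x, 0), (0, 0), (0, 0), 0) ((1, 0), (0, 0), (0, 0), 0) = ((int (Suc x), 0), (0, 0), (0, 0), 0)"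
      by (simp add: mod_simps)
    then show ?case using Suc loop_iff[OF loop_a, of "((int x, 0), (0, 0), (0, 0), 0)"]
      by (simp add: opposite_def del: ev.simps mulE.simps of_nat_Suc)
  qed
  have b: "P (Su, ev ((int x, 0), (int y, 0), (0, 0), 0)) \<longleftrightarrow> P (Su, oneK)" for x y
  proof (induction y)
    case 0 then show ?case using a by simp
  next
    case (Suc y)
    have "mulE ((int x, 0), (int y, 0), (0, 0), 0) ((0, 0), (1, 0), (0, 0), 0) = ((int x, 0), (int (Suc y), 0), (0, 0), 0)"
      by (simp add: mod_simps)
    then show ?case using Suc loop_iff[OF loop_b, of "((int x, 0), (int y, 0), (0, 0), 0)"]
      by (simp add: opposite_def del: ev.simps mulE.simps of_nat_Suc)
  qed
  have c: "P (Su, ev ((int x, 0), (int y, 0), (int z, 0), 0)) \<longleftrightarrow> P (Su, oneK)" for x y z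
  proof (induction z)
    case 0 then show ?case using b by simp
  next
    case (Suc z)
    have "mulE ((int x, 0), (int y, 0), (int z, 0), 0) ((0, 0), (0, 0), (1, 0), 0) = ((int x, 0), (int y, 0), (int (Suc z), 0), 0)"
      by (simp add: mod_simps)
    then show ?case using Suc loop_iff[OF loop_c, of "((int x, 0), (int y, 0), (int z, 0), 0)"]
      by (simp add: opposite_def del: ev.simps mulE.simps of_nat_Suc)
  qed
  have h: "e < 3 \<Longrightarrow> P (Su, ev ((int x, 0), (int y, 0), (int z, 0), e)) \<longleftrightarrow> P (Su, oneK)" for e
  proof (induction e)
    case 0 then show ?case using c by simp
  next
    case (Suc e)
    have "mulE ((int x, 0), (int y, 0), (int z, 0), e) ((0, 0), (0, 0), (0, 0), 1) = ((int x, 0), (int y, 0), (int z, 0), Suc e)"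
      using Suc.prems by simp
    then show ?case using Suc loop_iff[OF loop_h, of "((int x, 0), (int y, 0), (int z, 0), e)"]
      by (simp add: opposite_def del: ev.simps mulE.simps of_nat_Suc)
  qed
  from h[OF k(2)] show ?thesis
    using ev_lift[OF assms] by (simp add: k del: ev.simps ev_lift)
qed

lemma all_iff:
  assumes "x \<in> V" shows "P x \<longleftrightarrow> P (Su, oneK)"
proof -
  have u: "P y \<longleftrightarrow> P (Su, oneK)" if "y \<in> V" "fst y = Su" for y
    using that base_iff[of "snd y"] by (cases y) (simp add: in_V)
  have x: "P y \<longleftrightarrow> P (Su, oneK)" if "y \<in> V" "\<not> isU (fst y)" for y
    using that u[of "N Su y"] step_iff[of y Su] by (simp add: opposite_def)
  show ?thesis
    using assms x[of x] x[of "N Sx x"] step_iff[of x Sx] by (cases "isU (fst x)") (simp_all add: opposite_def)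
qed

lemma connected_induct: "x \<in> V \<Longrightarrow> P x \<Longrightarrow> y \<in> V \<Longrightarrow> P y"
  using all_iff by blast

end

lemma graph_connected: "graph_connected V adj"
  unfolding graph_connected_def
proof (intro ballI)
  fix x y assume "x \<in> V" "y \<in> V"
  let ?R = "{(p, q). p \<in> V \<and> q \<in> V \<and> adj p q}"
  show "(x, y) \<in> ?R\<^sup>*"
  proof (rule connected_induct[where P = "\<lambda>y. (x, y) \<in> ?R\<^sup>*" and x = x])
    fix z q assume "z \<in> V" "opposite (fst z) q" "(x, z) \<in> ?R\<^sup>*"
    then show "(x, N q z) \<in> ?R\<^sup>*"
      by (simp add: adj_N rtrancl_into_rtrancl[of x z])
  qed (simp_all add: \<open>x \<in> V\<close> \<open>y \<in> V\<close>)
qed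

lemma cubic: "cubic V adj"
  unfolding cubic_def
proof
  fix x assume x: "x \<in> V"
  have "{y \<in> V. adj x y} = (\<lambda>q. N q x) ` set (nbrs (fst x))"
    using x by (auto simp: adj_iff)
  moreover have "inj_on (\<lambda>q. N q x) (set (nbrs (fst x)))"
    by (auto simp: inj_on_def N_def)
  moreover have "card (set (nbrs (fst x))) = 3"
    by (cases "fst x") (simp_all add: nbrs_def del: set_nbrs)
  ultimately show "card {y \<in> V. adj x y} = 3"
    by (simp add: card_image del: set_nbrs)
qed

end

section \<open>Group laws for the liftable permutations\<close>

lemma set_all_syms [simp]: "s \<in> set all_syms"
  by (cases s) (auto simp: all_syms_def)

lemma perms_length: "l \<in> set perms \<Longrightarrow> length l = 6"
  by (auto simp: perms_eq_words)

lemma gen_comp: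
  assumes "m \<in> set perms" "g = gen1 \<or> g = gen2"
  shows "comp_perm g m \<in> set perms" "chi (comp_perm g m) = (chi m + 1) mod 4"
  using assms perms_gen by (auto simp: list_all_iff)

lemma comp_perm_assoc: "length m = 6 \<Longrightarrow> comp_perm (comp_perm g l) m = comp_perm g (comp_perm l m)"
  if "length l = 6"
  using that by (auto simp: comp_perm_def app_comp_perm[unfolded comp_perm_def])

lemma comp_all_syms [simp]: "comp_perm all_syms m = m"
  by (simp add: comp_perm_def map_idI)

lemma all_syms_in_perms: "all_syms \<in> set perms" and chi_all_syms: "chi all_syms = 0"
  by code_simp+

lemma chi_less_table: "list_all (\<lambda>l. chi l < 4) perms"
  by code_simp

lemma chi_less: "l \<in> set perms \<Longrightarrow> chi l < 4"
  using chi_less_table by (auto simp: list_all_iff)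

lemma eval_word_comp:
  assumes "m \<in> set perms"
  shows "comp_perm (eval_word w) m \<in> set perms \<and> chi (comp_perm (eval_word w) m) = (length w + chi m) mod 4"
proof (induction w)
  case Nil
  have "chi m < 4"
    using assms by (rule chi_less)
  then show ?case using assms by simp
next
  case (Cons b w)
  then show ?case
    using gen_comp[of "comp_perm (eval_word w) m" "if b then gen2 else gen1"] perms_length[OF assms]
    by (simp add: comp_perm_assoc mod_simps)
qed


lemma comp_all_syms_right: "length l = 6 \<Longrightarrow> comp_perm l all_syms = l"
  by (auto simp: comp_perm_def all_syms_def app_perm_def numeral_eq_Suc length_Suc_conv)

lemma perms_comp:
  assumes "l \<in> set perms" "m \<in> set perms"
  shows "comp_perm l m \<in> set perms" "chi (comp_perm l m) = (chi l + chi m) mod 4"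
proof -
  obtain w where w: "l = eval_word w"
    using assms(1) by (auto simp: perms_eq_words)
  have "chi l = length w mod 4"
    using eval_word_comp[OF all_syms_in_perms, of w] by (simp add: w comp_all_syms_right chi_all_syms)
  then show "comp_perm l m \<in> set perms" "chi (comp_perm l m) = (chi l + chi m) mod 4"
    using eval_word_comp[OF assms(2), of w] by (auto simp: w mod_simps)
qed

lemma perms_inverse:
  assumes "l \<in> set perms" obtains m where "m \<in> set perms" "comp_perm l m = all_syms" "comp_perm m l = all_syms"
  using assms perms_inverse_table by (auto simp: list_all_iff list_ex_iff)

lemma app_perm_opposite: "l \<in> set perms \<Longrightarrow> opposite (app_perm l s) (app_perm l t) = opposite s t"
  and app_perm_inj: "l \<in> set perms \<Longrightarrow> app_perm l s = app_perm l t \<Longrightarrow> s = t"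
  using perms_opposite_table by (auto simp: list_all_iff)

lemma app_perm_surj:
  assumes "l \<in> set perms" obtains s where "q = app_perm l s"
proof -
  obtain m where "m \<in> set perms" "comp_perm l m = all_syms"
    using assms perms_inverse by blast
  then have "q = app_perm l (app_perm m q)"
    using app_comp_perm[of m l q] perms_length by simp
  then show thesis ..
qed

lemma perms_transitive:
  "opposite s t \<Longrightarrow> opposite t q \<Longrightarrow> s \<noteq> q \<Longrightarrow> \<exists>l\<in>set perms. app_perm l s = Sx \<and> app_perm l t = Su \<and> app_perm l q = Sy"
  using perms_transitive_table by (simp add: list_all_iff list_ex_iff)

fun nonbacktracking :: "sym \<Rightarrow> sym \<Rightarrow> sym list \<Rightarrow> bool" where
  "nonbacktracking p c [] = True"
| "nonbacktracking p c (t # ts) \<longleftrightarrow> opposite c t \<and> t \<noteq> p \<and> nonbacktracking c t ts"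

section \<open>Lifting the permutations to automorphisms of the cover\<close>

context ncg
begin

text \<open>Membership in \<open>Aut\<close> without extensionality, so that explicit maps can be
  composed by plain function composition.\<close>

definition graph_aut :: "(sym \<times> kel \<Rightarrow> sym \<times> kel) \<Rightarrow> bool" where
  "graph_aut f \<longleftrightarrow> bij_betw f V V \<and> (\<forall>x\<in>V. \<forall>y\<in>V. adj x y \<longleftrightarrow> adj (f x) (f y))"

definition lifts :: "sym list \<Rightarrow> (sym \<times> kel \<Rightarrow> sym \<times> kel) \<Rightarrow> bool" where
  "lifts l F \<longleftrightarrow> l \<in> set perms \<and> (\<forall>x\<in>V. F x \<in> V \<and> fst (F x) = app_perm l (fst x)) \<and>
     (\<forall>x\<in>V. \<forall>q. opposite (fst x) q \<longrightarrow> F (N q x) = N (app_perm l q) (F x))"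

lemma finite_K: "finite K"
  by (rule finite_subset[of _ "{0..int n} \<times> {0..int n} \<times> {0..int n} \<times> {..3}"])
     (auto simp: Kcarrier_def)

lemma UNIV_sym: "(UNIV :: sym set) = set all_syms"
  by auto

lemma finite_V: "finite V"
  unfolding NCG_V_def UNIV_sym using finite_K by blast

lemma base_in_V [simp]: "(s, oneK) \<in> V"
  by (simp add: in_V)

text \<open>The image is nonempty and closed under neighbours, hence everything by connectedness;
  injectivity follows because \<open>V\<close> is finite.\<close>

lemma lifts_bij:
  assumes "lifts l F" shows "bij_betw F V V"
proof -
  note e = assms[unfolded lifts_def]
  have "y \<in> F ` V" if "y \<in> V" for y
  proof (rule connected_induct[where P = "\<lambda>y. y \<in> F ` V" and x = "F (Su, oneK)"])
    fix y q assume y: "y \<in> V" "opposite (fst y) q" "y \<in> F ` V"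
    then obtain x where x: "x \<in> V" "y = F x" by blast
    obtain p where p: "q = app_perm l p"
      using e app_perm_surj by metis
    then have "opposite (fst x) p"
      using x y e app_perm_opposite by auto
    then have "N q y = F (N p x)"
      using e x p by auto
    then show "N q y \<in> F ` V"
      using x by auto
  qed (use that e in auto)
  then have "F ` V = V"
    using e by auto
  then show ?thesis
    using finite_V by (simp add: bij_betw_def eq_card_imp_inj_on)
qed

lemma lifts_graph_aut:
  assumes "lifts l F" shows "graph_aut F"
  unfolding graph_aut_def
proof (intro conjI ballI)
  note e = assms[unfolded lifts_def]
  show bij: "bij_betw F V V"
    using assms by (rule lifts_bij)
  fix x y assume x: "x \<in> V" and y: "y \<in> V"
  show "adj x y \<longleftrightarrow> adj (F x) (F y)"
  proof
    assume "adj x y"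
    then obtain q where "opposite (fst x) q" "y = N q x"
      using x y by (elim adjE)
    then show "adj (F x) (F y)"
      using x e adj_N[of "F x" "app_perm l q"] app_perm_opposite by auto
  next
    assume "adj (F x) (F y)"
    then obtain q where q: "opposite (fst (F x)) q" "F y = N q (F x)"
      using x y e by (elim adjE) auto
    obtain p where p: "q = app_perm l p"
      using e app_perm_surj by metis
    then have o: "opposite (fst x) p"
      using x e app_perm_opposite q by auto
    then have "F y = F (N p x)"
      using e x p q by auto
    then have "y = N p x"
      using bij x y by (auto simp: bij_betw_def inj_on_eq_iff)
    then show "adj x y"
      using adj_N x o by simp
  qed
qed

lemma lifts_comp:
  assumes "lifts l F" "lifts m G" shows "lifts (comp_perm l m) (F \<circ> G)"
  using assms perms_comp[of l m] app_comp_perm[of m l] perms_length[of m] app_perm_opposite[of m]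
  unfolding lifts_def by auto

text \<open>Left translations commute with right multiplication by voltages; they are the deck
  transformations of the cover.\<close>

lemma lifts_left: "k \<in> K \<Longrightarrow> lifts all_syms (\<lambda>x. (fst x, mul k (snd x)))"
  unfolding lifts_def by (auto simp: all_syms_in_perms in_V N_def mul_assoc ev_in_K)

text \<open>The last hypothesis says that \<open>T\<close> descends modulo \<open>n\<close>. It
  compensates for \<open>lift\<close> not being multiplicative: \<open>lift\<close> of a product may
  be replaced by the product in \<open>kE\<close>.\<close>

lemma lifts_of_cocycle:
  assumes "l \<in> set perms" "\<And>s g. ang g < 3 \<Longrightarrow> ang (T s g) < 3"
    and "\<And>s t g. opposite s t \<Longrightarrow> ang g < 3 \<Longrightarrow> T t (mulE g (volt s t)) = mulE (T s g) (volt (app_perm l s) (app_perm l t))"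
    and "\<And>s g h. ang g < 3 \<Longrightarrow> ang h < 3 \<Longrightarrow> ev g = ev h \<Longrightarrow> ev (T s g) = ev (T s h)"
  shows "lifts l (\<lambda>x. (app_perm l (fst x), ev (T (fst x) (lift (snd x)))))"
proof -
  have "ev (T t (lift (mul k (ev (volt s t))))) = mul (ev (T s (lift k))) (ev (volt (app_perm l s) (app_perm l t)))"
    if "k \<in> K" "opposite s t" for k s t
  proof -
    have "ev (T t (lift (mul k (ev (volt s t))))) = ev (T t (mulE (lift k) (volt s t)))"
      using that by (intro assms(4)) (auto simp: ev_in_K ev_mulE)
    also have "\<dots> = mul (ev (T s (lift k))) (ev (volt (app_perm l s) (app_perm l t)))"
      using that by (simp add: assms(3) assms(2) ev_mulE)
    finally show ?thesis .
  qed
  then show ?thesis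
    using assms(1,2) by (auto simp: lifts_def in_V N_def ev_in_K)
qed

lemma ang_phi1 [simp]: "ang (phi1 g) = ang g"
  by (cases g) simp

lemma ang_phi2 [simp]: "ang (phi2 g) = ang g"
  by (cases g) simp

lemma gen_in_perms: "gen1 \<in> set perms" "gen2 \<in> set perms"
  by code_simp+

lemma lifts_gen1: "lifts gen1 (\<lambda>x. (app_perm gen1 (fst x), ev (mulE (phi1 (lift (snd x))) (corr1 (fst x)))))"
proof (rule lifts_of_cocycle[of gen1 "\<lambda>s g. mulE (phi1 g) (corr1 s)"])
  fix s g h assume "ang g < 3" "ang h < 3" "ev g = ev h"
  moreover from this have "ev (phi1 g) = ev (phi1 h)"
    by (cases g; cases h) (simp add: val_add val_neg val_rot del: rot.simps)
  ultimately show "ev (mulE (phi1 g) (corr1 s)) = ev (mulE (phi1 h) (corr1 s))"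
    by (simp add: ev_mulE)
qed (auto simp: gen_in_perms lift1_step)

lemma lifts_gen2: "lifts gen2 (\<lambda>x. (app_perm gen2 (fst x), ev (mulE (phi2 (lift (snd x))) (corr2 (fst x)))))"
proof (rule lifts_of_cocycle[of gen2 "\<lambda>s g. mulE (phi2 g) (corr2 s)"])
  fix s g h assume "ang g < 3" "ang h < 3" "ev g = ev h"
  moreover from this have "ev (phi2 g) = ev (phi2 h)"
    by (cases g; cases h) (simp add: val_add val_neg val_rot del: rot.simps)
  ultimately show "ev (mulE (phi2 g) (corr2 s)) = ev (mulE (phi2 h) (corr2 s))"
    by (simp add: ev_mulE)
qed (auto simp: gen_in_perms lift2_step)

lemma lifts_ex: "l \<in> set perms \<Longrightarrow> \<exists>F. lifts l F"
proof -
  have "\<exists>F. lifts (eval_word w) F" for w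
  proof (induction w)
    case Nil
    then show ?case using lifts_left[OF oneK_closed] by auto
  next
    case (Cons b w)
    then show ?case
      using lifts_comp[OF lifts_gen1] lifts_comp[OF lifts_gen2] by (cases b) (simp, blast)+
  qed
  then show "\<exists>F. lifts l F" if "l \<in> set perms"
    using that by (auto simp: perms_eq_words)
qed

lemma N_base: "volt s t = oneE \<Longrightarrow> N t (s, oneK) = (t, oneK)"
  by (simp add: N_def flip: oneK_def)

lemma N_Su [simp]: "N Su (Sx, oneK) = (Su, oneK)" "N Su (Sy, oneK) = (Su, oneK)"
  by (rule N_base; simp add: volt_def oneE_def)+

text \<open>A lifted permutation corrects the symbols and a left translation then moves the middle
  vertex to \<open>(Su, oneK)\<close>. The end vertices follow because the edges
  \<open>u - x\<close> and \<open>u - y\<close> have trivial voltage.\<close>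

lemma lifts_to_base:
  assumes x: "x \<in> V" and s: "opposite (fst x) s" and t: "opposite (fst x) t" and "s \<noteq> t"
  obtains l F where "lifts l F" "F (N s x) = (Sx, oneK)" "F x = (Su, oneK)" "F (N t x) = (Sy, oneK)"
proof -
  obtain l where l: "l \<in> set perms" "app_perm l s = Sx" "app_perm l (fst x) = Su" "app_perm l t = Sy"
    using perms_transitive[of s "fst x" t] s[unfolded opposite_sym[of "fst x"]] t \<open>s \<noteq> t\<close> by blast
  obtain F where F: "lifts l F"
    using lifts_ex l by blast
  then have Fx: "F x \<in> V" "fst (F x) = Su"
    using x l by (auto simp: lifts_def)
  then obtain h where h: "h \<in> K" "mul h (snd (F x)) = oneK"
    using inverse_ex by (metis in_V)
  define G where "G = (\<lambda>x. (fst x, mul h (snd x))) \<circ> F"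
  have G: "lifts l G"
    using lifts_comp[OF lifts_left[OF h(1)] F] by (simp add: G_def)
  have "G x = (Su, oneK)"
    using Fx h by (simp add: G_def)
  moreover from this have "G (N s x) = (Sx, oneK)" "G (N t x) = (Sy, oneK)"
    using G x s t l by (auto simp: lifts_def N_base volt_def)
  ultimately show thesis
    using that G by blast
qed

section \<open>Every automorphism permutes the fibres\<close>

lemma graph_aut_bij: "graph_aut f \<Longrightarrow> bij_betw f V V"
  by (simp add: graph_aut_def)

lemma graph_aut_closed [simp]: "graph_aut f \<Longrightarrow> x \<in> V \<Longrightarrow> f x \<in> V"
  using graph_aut_bij bij_betwE by blast

lemma graph_aut_inj: "graph_aut f \<Longrightarrow> x \<in> V \<Longrightarrow> y \<in> V \<Longrightarrow> f x = f y \<Longrightarrow> x = y"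
  using graph_aut_bij unfolding bij_betw_def by (blast dest: inj_onD)

lemma graph_aut_adj: "graph_aut f \<Longrightarrow> x \<in> V \<Longrightarrow> y \<in> V \<Longrightarrow> adj (f x) (f y) \<longleftrightarrow> adj x y"
  unfolding graph_aut_def by blast

lemma graph_aut_comp: "graph_aut f \<Longrightarrow> graph_aut g \<Longrightarrow> graph_aut (f \<circ> g)"
  unfolding graph_aut_def[of "f \<circ> g"]
  using bij_betw_trans[OF graph_aut_bij[of g] graph_aut_bij[of f]] by (simp add: graph_aut_adj)

lemma graph_aut_N:
  assumes "graph_aut f" "x \<in> V" "opposite (fst x) q"
  shows "opposite (fst (f x)) (fst (f (N q x)))" "f (N q x) = N (fst (f (N q x))) (f x)"
proof -
  have "adj (f x) (f (N q x))"
    using assms adj_N[of x q] by (simp add: graph_aut_adj)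
  then show "opposite (fst (f x)) (fst (f (N q x)))" "f (N q x) = N (fst (f (N q x))) (f x)"
    using assms adj_iff[of "f x" "f (N q x)"] by auto
qed

text \<open>The symbols along the image of a walk are unknown, but injectivity of \<open>f\<close>
  keeps that image non-backtracking, so it is among the walks explored by
  \<open>no_return\<close>.\<close>

lemma no_return_sound:
  assumes f: "graph_aut f"
  shows "no_return k (fst (f p)) b g \<Longrightarrow> p \<in> V \<Longrightarrow> opposite (fst p) c \<Longrightarrow> f (N c p) = (b, ev g) \<Longrightarrow> ang g < 3 \<Longrightarrow>
    length ts = k \<Longrightarrow> nonbacktracking (fst p) c ts \<Longrightarrow> f (walk (N c p) ts) \<noteq> (Sx, oneK)"
proof (induction ts arbitrary: k p b c g)
  case Nil
  then show ?case using ev_nontrivial by (auto split: if_splits)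
next
  case (Cons t ts)
  obtain k' where k: "k = Suc k'" "length ts = k'"
    using Cons.prems by auto
  define c' where "c' = N c p"
  have c': "c' \<in> V" "fst c' = c" "f c' = (b, ev g)"
    using Cons.prems by (auto simp: c'_def)
  have t: "opposite c t" "t \<noteq> fst p" "nonbacktracking c t ts"
    using Cons.prems by auto
  define q where "q = fst (f (N t c'))"
  have q: "opposite b q" "f (N t c') = N q (b, ev g)"
    using graph_aut_N[OF f c'(1), of t] t c' by (auto simp: q_def)
  have p: "N (fst p) c' = p"
    using Cons.prems by (simp add: c'_def)
  have "q \<noteq> fst (f p)"
  proof
    assume "q = fst (f p)"
    then have "f (N t c') = f p"
      using graph_aut_N(2)[OF f c'(1), of "fst p"] Cons.prems(3) q c' p opposite_sym by auto
    then have "N t c' = p"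
      using graph_aut_inj[OF f] Cons.prems(2) c' by auto
    then show False
      using t by auto
  qed
  then have "no_return k' b q (mulE g (volt b q))"
    using Cons.prems(1) q(1) by (auto simp: k list_all_iff)
  moreover have "f (N t c') = (q, ev (mulE g (volt b q)))"
    using q Cons.prems(5) by (simp add: N_def ev_mulE)
  ultimately have "f (walk (N t c') ts) \<noteq> (Sx, oneK)"
    using Cons.IH[of k' c' q "mulE g (volt b q)" t] c' t k Cons.prems(5) by auto
  then show ?case
    by (simp add: c'_def)
qed

lemma walk_cycle:
  assumes "k \<in> K" "opposite a b" "opposite b c" "opposite c d" "a \<noteq> c" "b \<noteq> d"
  shows "walk (a, k) [b, c, d, a, b, c, d, a, b, c, d, a] = (a, k)"
proof -
  have "walkE oneE a [b, c, d, a, b, c, d, a, b, c, d, a] = oneE"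
    using four_cycle_cubed assms(2-6) by (auto simp: list_all_iff simp del: walkE.simps)
  then show ?thesis
    using walk_mul[OF assms(1), of a "[b, c, d, a, b, c, d, a, b, c, d, a]"] assms(1)
    by (simp add: oneK_def[symmetric] del: walk.simps walkE.simps)
qed

text \<open>The 12-cycles are exactly the lifts of 4-cycles of \<open>K\<^sub>3\<^sub>,\<^sub>3\<close> traversed three times, so every automorphism respects
  the relation "opposite ends of a lifted 4-cycle".\<close>

lemma opposite_fibre:
  assumes f: "graph_aut f" and x: "x \<in> V" and o: "opposite (fst x) b" "opposite b c" "opposite c d" "fst x \<noteq> c" "b \<noteq> d"
  shows "fst (f (N (fst x) (N d (N c (N b x))))) = fst (f x)"
proof -
  define a where "a = fst x"
  have oa: "opposite a b" "opposite d a" "opposite b a"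
    using o by (auto simp: a_def opposite_def)
  define x1 where "x1 = N b x"
  define x2 where "x2 = N c x1"
  define x3 where "x3 = N d x2"
  define x4 where "x4 = N a x3"
  have V: "x1 \<in> V" "x2 \<in> V" "x3 \<in> V" "x4 \<in> V"
    using x by (simp_all add: x1_def x2_def x3_def x4_def)
  have fs: "fst x1 = b" "fst x2 = c" "fst x3 = d" "fst x4 = a"
    by (simp_all add: x1_def x2_def x3_def x4_def)
  have bk: "N a x1 = x" "N b x2 = x1" "N c x3 = x2"
    using N_N[OF x] N_N[OF V(1)] N_N[OF V(2)] o fs by (simp_all add: x1_def x2_def x3_def a_def)
  let ?s = "fst (f x)" and ?t = "fst (f x2)"
  have fx: "f x = N ?s (f x1)" "opposite (fst (f x1)) ?s"
    using graph_aut_N[OF f V(1), of a] oa bk fs by auto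
  have fx2: "f x2 = N ?t (f x1)" "opposite (fst (f x1)) ?t"
    using graph_aut_N[OF f V(1), of c] o fs x2_def by auto
  have "x \<noteq> x2"
    using o fs by auto
  then have "?s \<noteq> ?t"
    using fx fx2 graph_aut_inj[OF f x V(2)] by metis
  \<comment> \<open>Normalise the image of the 2-arc \<open>x, x1, x2\<close> to the reference
    2-arc, the only one treated by \<open>no_other_12_cycle\<close>.\<close>
  then obtain l G where G: "lifts l G" "G (f x) = (Sx, oneK)" "G (f x1) = (Su, oneK)" "G (f x2) = (Sy, oneK)"
    using lifts_to_base[OF graph_aut_closed[OF f V(1)] fx(2) fx2(2)] unfolding fx(1)[symmetric] fx2(1)[symmetric]
    by blast
  define h where "h = G \<circ> f"
  have h: "graph_aut h"
    unfolding h_def using lifts_graph_aut[OF G(1)] f by (rule graph_aut_comp)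
  have hx: "h x = (Sx, oneK)" "h x1 = (Su, oneK)" "h x2 = (Sy, oneK)"
    using G by (auto simp: h_def)
  let ?d = "fst (h x3)" and ?e = "fst (h x4)"
  have d: "opposite Sy ?d" "h x3 = N ?d (Sy, oneK)"
    using graph_aut_N[OF h V(2), of d] o fs hx by (auto simp: x3_def)
  have e: "opposite ?d ?e" "h x4 = N ?e (h x3)"
    using graph_aut_N[OF h V(3), of a] oa fs by (auto simp: x4_def)
  have "?d \<noteq> Su"
  proof
    assume "?d = Su"
    then have "h x3 = h x1"
      using d hx by (simp add: N_base volt_def)
    then show False
      using graph_aut_inj[OF h V(3) V(1)] fs o by auto
  qed
  have "?e \<noteq> Sy"
  proof
    assume "?e = Sy"
    then have "h x4 = h x2"
      using N_N[of "(Sy, oneK)" ?d] d e hx by simp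
    then show False
      using graph_aut_inj[OF h V(4) V(2)] fs o by (auto simp: a_def)
  qed
  \<comment> \<open>Otherwise the remaining eight steps of the 12-cycle through \<open>x\<close>
    could not bring its image back to \<open>(Sx, oneK)\<close>.\<close>
  have "?e = Sx"
  proof (rule ccontr)
    assume "?e \<noteq> Sx"
    let ?g = "walkE oneE Sx [Su, Sy, ?d, ?e]"
    have "no_return 8 ?d ?e ?g"
      using no_other_12_cycle \<open>?d \<noteq> Su\<close> \<open>?e \<noteq> Sy\<close> \<open>?e \<noteq> Sx\<close> d e
      by (auto simp: list_all_iff simp del: walkE.simps no_return.simps)
    moreover have "h x4 = (?e, ev ?g)"
    proof -
      have "h x4 = walk (Sx, oneK) [Su, Sy, ?d, ?e]"
        using d e by (simp add: N_base volt_def)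
      also have "\<dots> = (?e, ev ?g)"
        unfolding oneK_def by (subst walk_ev) simp_all
      finally show ?thesis .
    qed
    ultimately have "h (walk (N a x3) [b, c, d, a, b, c, d, a]) \<noteq> (Sx, oneK)"
      unfolding x4_def[symmetric]
    proof (intro no_return_sound[OF h, of 8 x3 ?e ?g a "[b, c, d, a, b, c, d, a]", folded x4_def])
      show "nonbacktracking (fst x3) a [b, c, d, a, b, c, d, a]"
        using oa o fs by (auto simp: a_def)
    qed (use V oa fs in simp_all)
    moreover have "walk (N a x3) [b, c, d, a, b, c, d, a] = walk x [b, c, d, a, b, c, d, a, b, c, d, a]"
      by (simp add: x3_def x2_def x1_def)
    moreover have "\<dots> = x"
      using walk_cycle[of "snd x" a b c d] o x by (simp add: a_def in_V del: walk.simps)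
    ultimately show False
      using hx by simp
  qed
  moreover have Gf: "fst (G (f y)) = app_perm l (fst (f y))" if "y \<in> V" for y
    using G(1) f that by (simp add: lifts_def)
  have "?e = app_perm l (fst (f x4))" "Sx = app_perm l ?s"
    using Gf[OF V(4)] Gf[OF x] G(2) by (simp_all add: h_def)
  ultimately have "fst (f x4) = ?s"
    using app_perm_inj[of l "fst (f x4)" ?s] G(1) by (simp add: lifts_def)
  then show ?thesis
    by (simp add: x4_def x3_def x2_def x1_def a_def)
qed

text \<open>In the main case this is \<open>opposite_fibre\<close> for the 4-cycle \<open>q\<close>,
  \<open>fst x\<close>, \<open>t\<close>, \<open>u\<close>, started at the neighbour
  \<open>N q x\<close>.\<close>

lemma two_step_fibre:
  assumes f: "graph_aut f" and x: "x \<in> V" and "opposite (fst x) t" "opposite t u" "opposite (fst x) q"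
  shows "fst (f (N q (N u (N t x)))) = fst (f (N q x))"
proof -
  consider "u = fst x" | "q = t" "u \<noteq> fst x" | "q \<noteq> t" "u \<noteq> fst x" by blast
  then show ?thesis
  proof cases
    case 1
    then show ?thesis using x assms by simp
  next
    case 2
    then show ?thesis using x assms N_N[of "N t x" u] by simp
  next
    case 3
    then show ?thesis
      using opposite_fibre[OF f, of "N q x" "fst x" t u] x assms opposite_sym by auto
  qed
qed

lemma fibres:
  assumes f: "graph_aut f"
  obtains \<pi> where "\<And>x. x \<in> V \<Longrightarrow> fst (f x) = \<pi> (fst x)"
proof -
  define \<pi> where "\<pi> q = (if opposite Su q then fst (f (N q (Su, oneK))) else fst (f (N q (Sx, oneK))))" for q
  \<comment> \<open>Two clauses make \<open>P\<close> pass along an edge: the first clause at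
    \<open>N t x\<close> is the second at \<open>x\<close>, and the second follows from the first at
    \<open>x\<close> by \<open>two_step_fibre\<close>.\<close>
  define P where "P x \<longleftrightarrow> (\<forall>q. opposite (fst x) q \<longrightarrow> fst (f (N q x)) = \<pi> q) \<and>
      (\<forall>t q. opposite (fst x) t \<longrightarrow> opposite t q \<longrightarrow> fst (f (N q (N t x))) = \<pi> q)" for x
  have "P x" if "x \<in> V" for x
  proof (rule connected_induct[where P = P and x = "(Su, oneK)"])
    show "P (Su, oneK)"
      unfolding P_def
    proof (intro conjI allI impI)
      fix t q assume "opposite (fst (Su, oneK)) t" "opposite t q"
      then show "fst (f (N q (N t (Su, oneK)))) = \<pi> q"
        using two_step_fibre[OF f, of "(Sx, oneK)" Su t q]
        by (auto simp: N_base volt_def \<pi>_def opposite_def)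
    qed (simp add: \<pi>_def)
    fix x t assume x: "x \<in> V" "opposite (fst x) t" "P x"
    show "P (N t x)"
      unfolding P_def
    proof (intro conjI allI impI)
      fix u q assume "opposite (fst (N t x)) u" "opposite u q"
      then show "fst (f (N q (N u (N t x)))) = \<pi> q"
        using two_step_fibre[OF f x(1,2), of u q] x by (auto simp: P_def opposite_def)
    qed (use x in \<open>auto simp: P_def\<close>)
  qed (use that in simp_all)
  then have P: "P (N q x)" if "x \<in> V" for q x
    using that by simp
  have "fst (f x) = \<pi> (fst x)" if "x \<in> V" for x
  proof -
    obtain t where t: "opposite (fst x) t"
      by (metis isU.simps(1,4) opposite_def)
    then show ?thesis
      using P[OF that, of t] N_N[OF that t] opposite_sym[of t "fst x"] unfolding P_def by (metis fst_N)
  qed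
  then show thesis
    using that by blast
qed

section \<open>Rigidity: an automorphism fixing a 2-arc is trivial\<close>

lemma graph_aut_walk:
  assumes "graph_aut f" "\<And>x. x \<in> V \<Longrightarrow> fst (f x) = \<pi> (fst x)"
  shows "x \<in> V \<Longrightarrow> alternating (fst x) ts \<Longrightarrow> f (walk x ts) = walk (f x) (map \<pi> ts)"
proof (induction ts arbitrary: x)
  case (Cons t ts)
  have "f (N t x) = N (\<pi> t) (f x)"
    using graph_aut_N(2)[OF assms(1), of x t] assms(2)[of "N t x"] Cons.prems by simp
  then show ?case
    using Cons.IH[of "N t x"] Cons.prems by simp
qed simp

text \<open>The second walk spells \<open>h^-1 a h\<close>: \<open>loop_h\<close> reversed,
  \<open>loop_a\<close>, \<open>loop_h\<close>. The first and third arise from \<open>loop_a\<close>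
  and the second by exchanging \<open>v\<close> and \<open>w\<close>.\<close>

lemma swap_loop:
  "walkE oneE Su [Sy, Sw, Sz, Sv, Sx, Su] = ((0, 0), (1, 0), (-1, 0), 0)"
  "walkE oneE Su [Sz, Sv, Sy, Su, Sy, Sv, Sz, Sw, Sx, Su, Sy, Sv, Sz, Su] = ((0, 1), (0, 0), (0, 0), 0)"
  "walkE oneE Su [Sz, Sw, Sy, Su, Sy, Sw, Sz, Sv, Sx, Su, Sy, Sw, Sz, Su] = ((0, 0), (-1, -1), (1, 1), 0)"
  by code_simp+

text \<open>Swapping \<open>v\<close> and \<open>w\<close> would conjugate \<open>h\<close> into an element acting as \<open>r\<^sup>2\<close>, while \<open>a ^ h = a ^ r\<close> forces it
  to act as \<open>r\<close> on the image of \<open>a\<close>. Hence \<open>1 + 2 r\<close> vanishes modulo \<open>n\<close>, although its norm is 3.\<close>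

lemma no_swap:
  assumes f: "graph_aut f" and \<pi>: "\<And>x. x \<in> V \<Longrightarrow> fst (f x) = \<pi> (fst x)"
    and base: "f (Su, oneK) = (Su, oneK)"
    and p: "\<pi> Su = Su" "\<pi> Sx = Sx" "\<pi> Sy = Sy" "\<pi> Sz = Sz" "\<pi> Sv = Sw" "\<pi> Sw = Sv"
  shows False
proof -
  note w = graph_aut_walk[OF f \<pi>]
  have pow: "f (Su, ev ((int i, 0), (0, 0), (0, 0), 0)) = (Su, ev ((0, 0), (int i, 0), (- int i, 0), 0))" for i
  proof (induction i)
    case 0
    then show ?case using base by (simp add: oneK_def oneE_def)
  next
    case (Suc i)
    let ?g = "((int i, 0), (0, 0), (0, 0), 0)" and ?h = "((0, 0), (int i, 0), (- int i, 0), 0)"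
    have "f (walk (Su, ev ?g) [Sy, Sv, Sz, Sw, Sx, Su]) = walk (Su, ev ?h) [Sy, Sw, Sz, Sv, Sx, Su]"
      using w[of "(Su, ev ?g)" "[Sy, Sv, Sz, Sw, Sx, Su]"] Suc
      by (simp add: p opposite_def in_V ev_in_K del: walk.simps ev.simps)
    then have "f (Su, ev (mulE ?g ((1, 0), (0, 0), (0, 0), 0))) = (Su, ev (mulE ?h ((0, 0), (1, 0), (-1, 0), 0)))"
      by (simp add: walk_mul ev_in_K loop_a swap_loop ev_mulE del: walk.simps walkE.simps ev.simps mulE.simps)
    then show ?case
      by (simp add: add.commute del: ev.simps)
  qed
  have "f (walk (Su, oneK) [Sz, Sv, Sy, Su, Sy, Sv, Sz, Sw, Sx, Su, Sy, Sv, Sz, Su]) =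
      walk (Su, oneK) [Sz, Sw, Sy, Su, Sy, Sw, Sz, Sv, Sx, Su, Sy, Sw, Sz, Su]"
    using w[of "(Su, oneK)" "[Sz, Sv, Sy, Su, Sy, Sv, Sz, Sw, Sx, Su, Sy, Sv, Sz, Su]"] base
    by (simp add: p opposite_def del: walk.simps)
  then have "f (Su, ev ((0, 1), (0, 0), (0, 0), 0)) = (Su, ev ((0, 0), (-1, -1), (1, 1), 0))"
    by (simp add: walk_mul swap_loop ev_in_K del: walk.simps walkE.simps ev.simps)
  \<comment> \<open>The exponents \<omega> and \<open>r mod int n\<close> of \<open>a\<close> give
    the same element of \<open>K\<close>, so \<open>pow\<close> yields a second expression for its
    image.\<close>
  moreover have "ev ((0, 1), (0, 0), (0, 0), 0) = ev ((int (nat (r mod int n)), 0), (0, 0), (0, 0), 0)"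
    using n7 by (simp add: val_def)
  ultimately have "ev ((0, 0), (-1, -1), (1, 1), 0) =
      ev ((0, 0), (int (nat (r mod int n)), 0), (- int (nat (r mod int n)), 0), 0)"
    using pow[of "nat (r mod int n)"] by (simp del: ev.simps)
  then have "(-1 - r) mod int n = r mod int n"
    using n7 by (simp add: val_def)
  then have "int n dvd -1 - r - r"
    by (simp only: mod_eq_dvd_iff)
  then have "int n dvd - (1 + 2 * r)"
    by (simp add: algebra_simps)
  then have "val (1, 2) = 0"
    by (simp add: val_def dvd_imp_mod_0 dvd_minus_iff del: minus_add_distrib)
  then show False
    using val_small[of "(1, 2)"] by simp
qed

text \<open>Preserving the parts and fixing \<open>x, u, y\<close> leaves only an exchange of
  \<open>v\<close> and \<open>w\<close>, excluded by \<open>no_swap\<close>. The identity then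
  spreads along edges.\<close>

lemma rigid:
  assumes f: "graph_aut f" and base: "f (Sx, oneK) = (Sx, oneK)" "f (Su, oneK) = (Su, oneK)" "f (Sy, oneK) = (Sy, oneK)"
    and x: "x \<in> V"
  shows "f x = x"
proof -
  obtain \<pi> where \<pi>: "\<And>x. x \<in> V \<Longrightarrow> fst (f x) = \<pi> (fst x)"
    using fibres[OF f] by blast
  have p3: "\<pi> Sx = Sx" "\<pi> Su = Su" "\<pi> Sy = Sy"
    using \<pi>[of "(Sx, oneK)"] \<pi>[of "(Su, oneK)"] \<pi>[of "(Sy, oneK)"] base by auto
  have N\<pi>: "f (N q y) = N (\<pi> q) (f y)" "opposite (\<pi> (fst y)) (\<pi> q)" if "y \<in> V" "opposite (fst y) q" for y q
    using graph_aut_N[OF f that] \<pi>[of "N q y"] \<pi>[of y] that by auto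
  have inj: "\<pi> q \<noteq> \<pi> q'" if "opposite s q" "opposite s q'" "q \<noteq> q'" for s q q'
  proof
    assume "\<pi> q = \<pi> q'"
    then have "f (N q (s, oneK)) = f (N q' (s, oneK))"
      using N\<pi>[of "(s, oneK)"] that by simp
    then show False
      using graph_aut_inj[OF f, of "N q (s, oneK)" "N q' (s, oneK)"] that by (metis N_closed base_in_V fst_N)
  qed
  have o: "opposite (\<pi> s) (\<pi> q)" if "opposite s q" for s q
    using N\<pi>(2)[of "(s, oneK)" q] that by simp
  have z: "\<pi> Sz = Sz"
    using o[of Su Sz] inj[of Su Sz Sx] inj[of Su Sz Sy] p3 by (cases "\<pi> Sz") (auto simp: opposite_def)
  have "\<pi> Sv = Sv \<or> \<pi> Sv = Sw" "\<pi> Sw = Sv \<or> \<pi> Sw = Sw" "\<pi> Sv \<noteq> \<pi> Sw"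
    using o[of Sx Sv] inj[of Sx Sv Su] o[of Sx Sw] inj[of Sx Sw Su] inj[of Sx Sv Sw] p3
    by (cases "\<pi> Sv"; cases "\<pi> Sw"; simp add: opposite_def)+
  moreover have "\<not> (\<pi> Sv = Sw \<and> \<pi> Sw = Sv)"
    using no_swap[OF f \<pi> base(2)] p3 z by blast
  ultimately have id: "\<pi> q = q" for q
    using p3 z by (cases q) auto
  show ?thesis
    by (rule connected_induct[where P = "\<lambda>x. f x = x" and x = "(Su, oneK)"])
       (simp_all add: N\<pi> id base x)
qed

end

lemma mod_shift_zero:
  fixes a b w m :: nat
  assumes "(w + (b + a)) mod m = (a + b) mod m" "w < m" shows "w = 0"
proof -
  have "m dvd (w + (a + b)) - (a + b)"
    using assms by (subst mod_eq_dvd_iff_nat[symmetric]) (simp_all add: add.commute)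
  then show ?thesis
    using assms(2) dvd_imp_le by fastforce
qed

section \<open>The automorphism group\<close>

lemma (in group) derived_subset:
  assumes "subgroup N G" "\<And>f g. f \<in> H \<Longrightarrow> g \<in> H \<Longrightarrow> f \<otimes> g \<otimes> inv f \<otimes> inv g \<in> N"
  shows "derived G H \<subseteq> N"
  unfolding derived_def using assms by (intro generate_subgroup_incl) auto

text \<open>Evaluates a multiplicative invariant on a commutator without knowing its value on
  inverses.\<close>

lemma (in group) commutator_mult:
  assumes "f \<in> carrier G" "g \<in> carrier G"
  shows "(f \<otimes> g \<otimes> inv f \<otimes> inv g) \<otimes> (g \<otimes> f) = f \<otimes> g"
proof -
  have "inv g \<otimes> (g \<otimes> f) = f"
    using assms by (simp flip: m_assoc)
  then show ?thesis
    using assms by (simp add: m_assoc)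
qed

context ncg
begin

abbreviation A where "A \<equiv> Aut V adj"

lemma graph_aut_cong:
  assumes "\<And>x. x \<in> V \<Longrightarrow> f x = g x" shows "graph_aut f \<longleftrightarrow> graph_aut g"
  using assms bij_betw_cong[of V f g V] by (simp add: graph_aut_def)

lemma graph_aut_inv_into:
  assumes f: "graph_aut f" shows "graph_aut (inv_into V f)"
proof -
  have bij: "bij_betw (inv_into V f) V V"
    using graph_aut_bij[OF f] by (rule bij_betw_inv_into)
  have "adj x y \<longleftrightarrow> adj (inv_into V f x) (inv_into V f y)" if "x \<in> V" "y \<in> V" for x y
  proof -
    have "inv_into V f x \<in> V" "inv_into V f y \<in> V"
      using bij that bij_betwE by blast+
    then show ?thesis
      using graph_aut_adj[OF f, of "inv_into V f x" "inv_into V f y"] bij_betw_inv_into_right[OF graph_aut_bij[OF f]] that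
      by simp
  qed
  with bij show ?thesis
    unfolding graph_aut_def by blast
qed

lemma carrier_A: "f \<in> carrier A \<longleftrightarrow> graph_aut f \<and> f \<in> extensional V"
  by (auto simp: Aut_def Bij_def graph_aut_def)

lemma mult_A: "f \<in> carrier A \<Longrightarrow> g \<in> carrier A \<Longrightarrow> f \<otimes>\<^bsub>A\<^esub> g = compose V f g"
  by (simp add: Aut_def BijGroup_def)

lemma one_A: "\<one>\<^bsub>A\<^esub> = (\<lambda>x\<in>V. x)"
  by (simp add: Aut_def BijGroup_def)

lemma restrict_A: "graph_aut f \<Longrightarrow> restrict f V \<in> carrier A"
  using graph_aut_cong[of "restrict f V" f] by (simp add: carrier_A)

lemma group_A: "group A"
proof -
  interpret B: group "BijGroup V" by (rule group_BijGroup)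
  have m: "f \<otimes>\<^bsub>BijGroup V\<^esub> g = compose V f g" if "f \<in> carrier A" "g \<in> carrier A" for f g
    using that by (simp add: BijGroup_def Aut_def)
  have "subgroup (carrier A) (BijGroup V)"
  proof (rule B.subgroupI)
    show "carrier A \<subseteq> carrier (BijGroup V)"
      by (auto simp: Aut_def BijGroup_def)
    show "carrier A \<noteq> {}"
      using restrict_A lifts_graph_aut lifts_left oneK_closed by blast
    fix f assume f: "f \<in> carrier A"
    then have "restrict (inv_into V f) V \<in> carrier A"
      using graph_aut_inv_into[of f] restrict_A by (simp add: carrier_A[of f])
    moreover have "f \<in> Bij V"
      using f by (simp add: Aut_def)
    ultimately show "inv\<^bsub>BijGroup V\<^esub> f \<in> carrier A"
      by (simp add: inv_BijGroup)
    fix g assume g: "g \<in> carrier A"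
    have "compose V f g \<in> carrier A"
      using f g graph_aut_comp[of f g] graph_aut_cong[of "compose V f g" "f \<circ> g"] by (simp add: carrier_A compose_eq)
    then show "f \<otimes>\<^bsub>BijGroup V\<^esub> g \<in> carrier A"
      using m[OF f g] by simp
  qed
  then have "group (BijGroup V\<lparr>carrier := carrier A\<rparr>)"
    by (rule B.subgroup_imp_group)
  then show ?thesis
    by (simp add: Aut_def)
qed

sublocale A: group A by (rule group_A)

section \<open>Projection of \<open>Aut\<close> to the 36 permutations and to the cyclic group of
  order 4\<close>

definition perm :: "(sym \<times> kel \<Rightarrow> sym \<times> kel) \<Rightarrow> sym list" where
  "perm f = map (\<lambda>s. fst (f (s, oneK))) all_syms"

text \<open>A lift \<open>G\<close> takes the image of the reference 2-arc back, so \<open>G\<close>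
  after \<open>f\<close> is the identity by \<open>rigid\<close>, and \<open>f\<close> projects to
  the inverse of the permutation under \<open>G\<close>.\<close>

lemma perm:
  assumes f: "graph_aut f"
  shows "perm f \<in> set perms" "x \<in> V \<Longrightarrow> fst (f x) = app_perm (perm f) (fst x)"
proof -
  have V: "f (Sx, oneK) \<in> V" "f (Su, oneK) \<in> V" "f (Sy, oneK) \<in> V"
    using f by auto
  let ?s = "fst (f (Sx, oneK))" and ?t = "fst (f (Sy, oneK))"
  have 1: "opposite (fst (f (Su, oneK))) ?s" "f (Sx, oneK) = N ?s (f (Su, oneK))"
    using graph_aut_N[OF f, of "(Su, oneK)" Sx] by (simp_all add: N_base opposite_def volt_def)
  have 2: "opposite (fst (f (Su, oneK))) ?t" "f (Sy, oneK) = N ?t (f (Su, oneK))"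
    using graph_aut_N[OF f, of "(Su, oneK)" Sy] by (simp_all add: N_base opposite_def volt_def)
  have "?s \<noteq> ?t"
    using 1 2 graph_aut_inj[OF f, of "(Sx, oneK)" "(Sy, oneK)"] by (metis base_in_V fst_conv sym.distinct(25))
  then obtain l G where G: "lifts l G" "G (f (Sx, oneK)) = (Sx, oneK)" "G (f (Su, oneK)) = (Su, oneK)" "G (f (Sy, oneK)) = (Sy, oneK)"
    using lifts_to_base[OF V(2) 1(1) 2(1)] unfolding 1(2)[symmetric] 2(2)[symmetric] by blast
  have id: "G (f x) = x" if "x \<in> V" for x
    using rigid[of "G \<circ> f" x] graph_aut_comp[OF lifts_graph_aut[OF G(1)] f] G that by simp
  have l: "l \<in> set perms"
    using G(1) by (simp add: lifts_def)
  then obtain m where m: "m \<in> set perms" "comp_perm m l = all_syms"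
    using perms_inverse by blast
  have *: "fst (f x) = app_perm m (fst x)" if "x \<in> V" for x
  proof -
    have "app_perm l (fst (f x)) = fst x"
      using G(1) f id[OF that] that by (metis lifts_def graph_aut_closed)
    then have "app_perm m (fst x) = app_perm (comp_perm m l) (fst (f x))"
      using app_comp_perm[of l m] perms_length[OF l] by simp
    then show ?thesis
      using m by simp
  qed
  have "perm f = comp_perm m all_syms"
    by (simp add: perm_def comp_perm_def * )
  then have "perm f = m"
    using comp_all_syms_right perms_length m by simp
  with * m show "perm f \<in> set perms" "x \<in> V \<Longrightarrow> fst (f x) = app_perm (perm f) (fst x)"
    by auto
qed

lemma perm_comp: "graph_aut f \<Longrightarrow> graph_aut g \<Longrightarrow> perm (compose V f g) = comp_perm (perm f) (perm g)"
  by (simp add: perm_def[of "compose V f g"] perm_def[of g] comp_perm_def compose_eq perm(2)[of f])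

lemma perm_one: "perm \<one>\<^bsub>A\<^esub> = all_syms"
  by (simp add: perm_def one_A all_syms_def)

definition phase :: "(sym \<times> kel \<Rightarrow> sym \<times> kel) \<Rightarrow> nat" where "phase f = chi (perm f)"

lemma perm_mult: "f \<in> carrier A \<Longrightarrow> g \<in> carrier A \<Longrightarrow> perm (f \<otimes>\<^bsub>A\<^esub> g) = comp_perm (perm f) (perm g)"
  by (simp add: mult_A perm_comp carrier_A)

lemma phase_mult: "f \<in> carrier A \<Longrightarrow> g \<in> carrier A \<Longrightarrow> phase (f \<otimes>\<^bsub>A\<^esub> g) = (phase f + phase g) mod 4"
  by (simp add: perm_mult phase_def perms_comp perm carrier_A)

lemma phase_one: "phase \<one>\<^bsub>A\<^esub> = 0"
  by (simp add: phase_def perm_one chi_all_syms)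

lemma phase_less: "f \<in> carrier A \<Longrightarrow> phase f < 4"
  by (simp add: phase_def chi_less perm carrier_A)

lemma phase_odd:
  assumes "f \<in> carrier A" "x \<in> V"
  shows "opposite (fst x) (fst (f x)) \<longleftrightarrow> odd (phase f)"
  using perms_odd_table assms by (auto simp: list_all_iff phase_def perm carrier_A)

section \<open>Regularity on 2-arcs and type \<open>2\<^sup>2\<close>\<close>

lemma rigid_arc:
  assumes f: "graph_aut f" and x: "x \<in> V" and st: "opposite (fst x) s" "opposite (fst x) t" "s \<noteq> t"
    and fx: "f x = x" "f (N s x) = N s x" "f (N t x) = N t x" and y: "y \<in> V"
  shows "f y = y"
proof -
  obtain l G where G: "lifts l G" "G (N s x) = (Sx, oneK)" "G x = (Su, oneK)" "G (N t x) = (Sy, oneK)"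
    using lifts_to_base[OF x st] .
  let ?F = "inv_into V G"
  have aG: "graph_aut G" "inj_on G V"
    using lifts_graph_aut[OF G(1)] graph_aut_bij bij_betw_def by blast+
  have F: "?F (G z) = z" if "z \<in> V" for z
    using aG that by simp
  \<comment> \<open>Conjugation by \<open>G\<close> moves the fixed 2-arc to the reference one,
    where \<open>rigid\<close> applies.\<close>
  have h: "graph_aut (G \<circ> f \<circ> ?F)"
    using aG f graph_aut_comp graph_aut_inv_into by blast
  have "?F (Sx, oneK) = N s x" "?F (Su, oneK) = x" "?F (Sy, oneK) = N t x"
    using F[of "N s x"] F[of x] F[of "N t x"] G x by simp_all
  note base = this
  have "(G \<circ> f \<circ> ?F) (G y) = G y"
    by (rule rigid[OF h]) (use base G fx y aG(1) in simp_all)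
  then show ?thesis
    using F[OF y] graph_aut_inj[OF aG(1)] y f by simp
qed

lemma arc2E:
  assumes "s_arc V adj 2 p"
  obtains x s t where "x \<in> V" "opposite (fst x) s" "opposite (fst x) t" "s \<noteq> t" "p = [N s x, x, N t x]"
proof -
  obtain a x b where p: "p = [a, x, b]"
    using assms by (auto simp: s_arc_def length_Suc_conv numeral_3_eq_3)
  have V: "a \<in> V" "x \<in> V" "b \<in> V"
    using assms by (auto simp: s_arc_def p)
  have "\<forall>i. 1 \<le> i \<and> i \<le> 2 \<longrightarrow> adj (p ! (i - 1)) (p ! i)"
    "\<forall>i. 1 \<le> i \<and> i < 2 \<longrightarrow> p ! (i - 1) \<noteq> p ! (i + 1)"
    using assms unfolding s_arc_def by blast+
  from this(1)[rule_format, of 1] this(1)[rule_format, of 2] this(2)[rule_format, of 1]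
  have "adj (p ! 0) (p ! 1)" "adj (p ! 1) (p ! 2)" "p ! 0 \<noteq> p ! 2"
    by (simp_all add: numeral_2_eq_2)
  then have "adj x a" "adj x b" "a \<noteq> b"
    using adj_sym by (auto simp: p)
  then show thesis
    using that[OF V(2)] V by (metis p adjE fst_N)
qed

lemma arc1E:
  assumes "s_arc V adj 1 p"
  obtains x s where "x \<in> V" "opposite (fst x) s" "p = [N s x, x]"
proof -
  obtain a x where p: "p = [a, x]"
    using assms by (auto simp: s_arc_def length_Suc_conv)
  have V: "a \<in> V" "x \<in> V"
    using assms by (auto simp: s_arc_def p)
  have "\<forall>i. 1 \<le> i \<and> i \<le> 1 \<longrightarrow> adj (p ! (i - 1)) (p ! i)"
    using assms unfolding s_arc_def by blast
  from this[rule_format, of 1] have "adj (p ! 0) (p ! 1)"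
    by simp
  then have "adj x a"
    using adj_sym by (auto simp: p)
  then show thesis
    using that[OF V(2)] V by (metis p adjE fst_N)
qed

lemma arc_to_arc:
  assumes "x \<in> V" "opposite (fst x) s" "opposite (fst x) t" "s \<noteq> t"
    "x' \<in> V" "opposite (fst x') s'" "opposite (fst x') t'" "s' \<noteq> t'"
  obtains f where "f \<in> carrier A" "f (N s x) = N s' x'" "f x = x'" "f (N t x) = N t' x'"
proof -
  obtain l G where G: "lifts l G" "G (N s x) = (Sx, oneK)" "G x = (Su, oneK)" "G (N t x) = (Sy, oneK)"
    using lifts_to_base assms(1-4) by blast
  obtain m F where F: "lifts m F" "F (N s' x') = (Sx, oneK)" "F x' = (Su, oneK)" "F (N t' x') = (Sy, oneK)"
    using lifts_to_base assms(5-8) by blast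
  have aut: "graph_aut (inv_into V F \<circ> G)"
    using F(1) G(1) lifts_graph_aut graph_aut_comp graph_aut_inv_into by blast
  have "inj_on F V"
    using F(1) lifts_bij bij_betw_def by blast
  then have "inv_into V F (F y) = y" if "y \<in> V" for y
    using that by simp
  from this[of "N s' x'"] this[of x'] this[of "N t' x'"] show thesis
    using that[OF restrict_A[OF aut]] assms F G by simp
qed

lemma arc_transitive: "arc_transitive V adj"
  unfolding arc_transitive_def
proof (intro allI impI)
  fix p q assume "s_arc V adj 1 p \<and> s_arc V adj 1 q"
  then obtain x s x' s' where x: "x \<in> V" "opposite (fst x) s" "p = [N s x, x]" "x' \<in> V" "opposite (fst x') s'" "q = [N s' x', x']"
    by (meson arc1E)
  have other: "\<exists>t. opposite u t \<and> s \<noteq> t" for u s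
    by (cases "isU u") (metis isU.simps opposite_def sym.distinct(1) sym.distinct(25))+
  obtain t t' where "opposite (fst x) t" "s \<noteq> t" "opposite (fst x') t'" "s' \<noteq> t'"
    using other by metis
  then show "\<exists>f\<in>carrier A. map f p = q"
    using arc_to_arc[of x s t x' s' t'] x by auto
qed

lemma two_regular: "two_regular V adj (carrier A)"
  unfolding two_regular_def
proof (intro conjI allI impI)
  show "subgroup (carrier A) A"
    by (rule A.subgroup_self)
  fix p q assume "s_arc V adj 2 p \<and> s_arc V adj 2 q"
  then obtain x s t x' s' t' where x: "x \<in> V" "opposite (fst x) s" "opposite (fst x) t" "s \<noteq> t" "p = [N s x, x, N t x]"
    "x' \<in> V" "opposite (fst x') s'" "opposite (fst x') t'" "s' \<noteq> t'" "q = [N s' x', x', N t' x']"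
    by (meson arc2E)
  show "\<exists>!f. f \<in> carrier A \<and> map f p = q"
  proof (rule ex_ex1I)
    show "\<exists>f. f \<in> carrier A \<and> map f p = q"
      using arc_to_arc[of x s t x' s' t'] x by auto
    fix f g assume f: "f \<in> carrier A \<and> map f p = q" and g: "g \<in> carrier A \<and> map g p = q"
    let ?h = "inv_into V g \<circ> f"
    have af: "graph_aut f" and ag: "graph_aut g"
      using f g by (auto simp: carrier_A)
    then have ah: "graph_aut ?h"
      using graph_aut_comp graph_aut_inv_into by blast
    have inv: "inv_into V g (g y) = y" if "y \<in> V" for y
      using graph_aut_bij[OF ag] that by (simp add: bij_betw_def)
    have "f (N s x) = g (N s x)" "f x = g x" "f (N t x) = g (N t x)"
      using f g x by auto
    then have fx: "?h x = x" "?h (N s x) = N s x" "?h (N t x) = N t x"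
      using inv x by simp_all
    have "f y = g y" if "y \<in> V" for y
    proof -
      have "inv_into V g (f y) = y"
        using rigid_arc[OF ah x(1-4) fx that] by simp
      then show ?thesis
        using bij_betw_inv_into_right[OF graph_aut_bij[OF ag], of "f y"] af that by simp
    qed
    then show "f = g"
      using f g by (intro extensionalityI[of f V g]) (auto simp: carrier_A)
  qed
qed

lemma type_2_2: "type_2_2 V adj (carrier A)"
proof -
  have False if f: "f \<in> carrier A" "f \<otimes>\<^bsub>A\<^esub> f = \<one>\<^bsub>A\<^esub>" and u: "u \<in> V" "v \<in> V" "adj u v" "f u = v" for f u v
  proof -
    have "odd (phase f)"
      using phase_odd[OF f(1) u(1)] u adj_iff by auto
    \<comment> \<open>Twice an odd number is 2 modulo 4, so this contradicts the odd phase.\<close>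
    moreover have "(phase f + phase f) mod 4 = 0"
      using phase_mult[OF f(1) f(1)] f phase_one by simp
    ultimately show False
      by presburger
  qed
  then show ?thesis
    unfolding type_2_2_def using two_regular by blast
qed

section \<open>No subgroup is regular on the vertices\<close>

lemma odd_n: "odd n"
proof
  assume "even n"
  then have "2 dvd int n" by simp
  also have "int n dvd r ^ 2 + r + 1"
    using r_root by auto
  \<comment> \<open>\<open>r ^ 2 + r\<close> is a product of consecutive integers, so adding 1 gives
    an odd number.\<close>
  finally show False by simp
qed

lemma card_K: "card K = 3 * n ^ 3"
proof -
  have "K = {0..<int n} \<times> {0..<int n} \<times> {0..<int n} \<times> {..<3}"
    by (auto simp: Kcarrier_def)
  then show ?thesis
    by (simp add: card_cartesian_product power3_eq_cube)
qed

lemma card_V: "card V = 18 * n ^ 3"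
  unfolding NCG_V_def UNIV_sym
  by (simp add: card_cartesian_product card_K) (simp add: all_syms_def)

lemma not_Cayley: "\<not> is_Cayley_graph V adj"
proof
  assume "is_Cayley_graph V adj"
  then obtain H where H: "subgroup H A" "regular_on_vertices V H"
    by (auto simp: is_Cayley_graph_def)
  have reg: "\<exists>!f. f \<in> H \<and> f x = y" if "x \<in> V" "y \<in> V" for x y
    using H(2) that by (simp add: regular_on_vertices_def)
  have HA: "H \<subseteq> carrier A"
    using H(1) by (rule subgroup.subset)
  have "bij_betw (\<lambda>f. f (Su, oneK)) H V"
    unfolding bij_betw_def
  proof
    show "inj_on (\<lambda>f. f (Su, oneK)) H"
    proof (rule inj_onI)
      fix f g assume f: "f \<in> H" and g: "g \<in> H" and eq: "f (Su, oneK) = g (Su, oneK)"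
      have "graph_aut g"
        using g HA carrier_A by blast
      then have "\<exists>!h. h \<in> H \<and> h (Su, oneK) = g (Su, oneK)"
        by (intro reg) simp_all
      then obtain u where u: "\<And>h. h \<in> H \<Longrightarrow> h (Su, oneK) = g (Su, oneK) \<Longrightarrow> h = u"
        by blast
      show "f = g"
        using u[OF f eq] u[OF g refl] by simp
    qed
    show "(\<lambda>f. f (Su, oneK)) ` H = V"
    proof
      show "(\<lambda>f. f (Su, oneK)) ` H \<subseteq> V"
        using HA by (auto simp: carrier_A)
      show "V \<subseteq> (\<lambda>f. f (Su, oneK)) ` H"
        using reg[of "(Su, oneK)"] by (metis (lifting) base_in_V image_eqI subsetI)
    qed
  qed
  then have card_H: "card H = 18 * n ^ 3" and fin: "finite H"
    using card_V finite_V bij_betw_same_card bij_betw_finite by (metis, blast)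
  obtain h where h: "h \<in> H" "h (Su, oneK) = (Sx, oneK)"
    using reg[of "(Su, oneK)" "(Sx, oneK)"] by auto
  have hA: "h \<in> carrier A"
    using h HA by auto
  then have odd: "odd (phase h)"
    using phase_odd[of h "(Su, oneK)"] h by (simp add: opposite_def)
  define C where "C i = {f \<in> H. phase f = i}" for i
  \<comment> \<open>Multiplication by \<open>h\<close> embeds each phase class in the next. As
    \<open>phase h\<close> is odd, the four inequalities form one cycle and all classes have equal
    size.\<close>
  have le: "card (C i) \<le> card (C j)" if "j = (phase h + i) mod 4" for i j
    unfolding that
  proof (rule card_inj_on_le[where f = "\<lambda>f. h \<otimes>\<^bsub>A\<^esub> f"])
    show "inj_on (\<lambda>f. h \<otimes>\<^bsub>A\<^esub> f) (C i)"
      using A.inj_on_multc hA HA by (auto simp: inj_on_def C_def subset_iff)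
    show "(\<lambda>f. h \<otimes>\<^bsub>A\<^esub> f) ` C i \<subseteq> C ((phase h + i) mod 4)"
      using H(1) h HA hA by (auto simp: C_def subset_iff phase_mult subgroup.m_closed)
    show "finite (C ((phase h + i) mod 4))"
      using fin by (simp add: C_def)
  qed
  have "m = 1 \<or> m = 3" if "odd m" "m < 4" for m :: nat
    using that by presburger
  then have "phase h = 1 \<or> phase h = 3"
    using odd phase_less[OF hA] by blast
  then have eq: "card (C 1) = card (C 0) \<and> card (C 2) = card (C 0) \<and> card (C 3) = card (C 0)"
  proof
    assume c: "phase h = 1"
    have "card (C 0) \<le> card (C 1)" "card (C 1) \<le> card (C 2)" "card (C 2) \<le> card (C 3)" "card (C 3) \<le> card (C 0)"
      by (rule le; simp add: c)+
    then show ?thesis by linarith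
  next
    assume c: "phase h = 3"
    have "card (C 0) \<le> card (C 3)" "card (C 3) \<le> card (C 2)" "card (C 2) \<le> card (C 1)" "card (C 1) \<le> card (C 0)"
      by (rule le; simp add: c)+
    then show ?thesis by linarith
  qed
  have "m = 0 \<or> m = 1 \<or> m = 2 \<or> m = 3" if "m < 4" for m :: nat
    using that by presburger
  then have "phase f = 0 \<or> phase f = 1 \<or> phase f = 2 \<or> phase f = 3" if "f \<in> H" for f
    using phase_less[OF subsetD[OF HA that]] by blast
  then have "H = C 0 \<union> C 1 \<union> C 2 \<union> C 3"
    unfolding C_def by blast
  moreover have "card (C 0 \<union> C 1 \<union> C 2 \<union> C 3) = card (C 0) + card (C 1) + card (C 2) + card (C 3)"
    using fin by (subst card_Un_disjoint; auto simp: C_def)+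
  ultimately have "18 * n ^ 3 = 4 * card (C 0)"
    using card_H eq by simp
  then have "even (9 * n ^ 3)"
    by presburger
  then show False
    using odd_n by simp
qed

section \<open>Solvability\<close>

definition shift :: "(sym \<times> kel \<Rightarrow> sym \<times> kel) \<Rightarrow> kel" where "shift f = snd (f (Su, oneK))"

definition angleK :: "kel \<Rightarrow> nat" where "angleK k = snd (snd (snd k))"

lemma shift_in_K: "f \<in> carrier A \<Longrightarrow> shift f \<in> K"
  by (simp add: shift_def carrier_A flip: in_V)

text \<open>The kernel of the projection consists of left translations by \<open>K\<close>: once
  symbols are preserved, the image of one vertex determines those of its neighbours.\<close>

lemma left_translation:
  assumes f: "f \<in> carrier A" and p: "perm f = all_syms" and x: "x \<in> V"
  shows "f x = (fst x, mul (shift f) (snd x))"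
proof -
  have a: "graph_aut f"
    using f by (simp add: carrier_A)
  have fs: "fst (f x) = fst x" if "x \<in> V" for x
    using perm(2)[OF a that] p by simp
  show ?thesis
  proof (rule connected_induct[where P = "\<lambda>x. f x = (fst x, mul (shift f) (snd x))" and x = "(Su, oneK)"])
    show "f (Su, oneK) = (fst (Su, oneK), mul (shift f) (snd (Su, oneK)))"
      using fs[of "(Su, oneK)"] shift_in_K[OF f] by (auto simp: shift_def prod_eq_iff)
    fix y q assume "y \<in> V" "opposite (fst y) q" "f y = (fst y, mul (shift f) (snd y))"
    then show "f (N q y) = (fst (N q y), mul (shift f) (snd (N q y)))"
      using graph_aut_N(2)[OF a, of y q] fs[of "N q y"] shift_in_K[OF f]
      by (simp add: N_def in_V ev_in_K mul_assoc)
  qed (use x in simp_all)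
qed

lemma shift_mult:
  assumes "f \<in> carrier A" "perm f = all_syms" "g \<in> carrier A"  "perm g = all_syms"
  shows "shift (f \<otimes>\<^bsub>A\<^esub> g) = mul (shift f) (shift g)"
proof -
  have "snd ((f \<otimes>\<^bsub>A\<^esub> g) (Su, oneK)) = snd (f (g (Su, oneK)))"
    using assms by (simp add: mult_A compose_eq)
  also have "g (Su, oneK) = (Su, shift g)"
    using left_translation[OF assms(3,4), of "(Su, oneK)"] shift_in_K[OF assms(3)] by simp
  also have "snd (f (Su, shift g)) = mul (shift f) (shift g)"
    using left_translation[OF assms(1,2), of "(Su, shift g)"] shift_in_K[OF assms(3)] by (simp add: in_V)
  finally show ?thesis
    by (simp add: shift_def)
qed

lemma shift_one: "shift \<one>\<^bsub>A\<^esub> = oneK"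
  by (simp add: shift_def one_A)

lemma angleK_mul: "angleK (mul g h) = (angleK g + angleK h) mod 3"
  by (cases g; cases h) (simp add: angleK_def)

lemma angleK_one: "angleK oneK = 0"
  by (simp add: angleK_def oneK_eq)

lemma angleK_less: "g \<in> K \<Longrightarrow> angleK g < 3"
  by (auto simp: angleK_def Kcarrier_def)

lemma mul_cancel:
  assumes "g \<in> K" "h \<in> K" "mul g h = h" shows "g = oneK"
proof -
  obtain k where "k \<in> K" "mul h k = oneK"
    using assms inverse_ex by blast
  then show ?thesis
    using assms mul_assoc[of g h k] by simp
qed

text \<open>Phrased with a left inverse \<open>g\<close> so that multiplicativity alone determines
  the invariants of \<open>g\<close>.\<close>

lemma subgroupI_kernel:
  assumes "D \<subseteq> carrier A" "\<one>\<^bsub>A\<^esub> \<in> D"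
    "\<And>f g. f \<in> D \<Longrightarrow> g \<in> D \<Longrightarrow> f \<otimes>\<^bsub>A\<^esub> g \<in> D" "\<And>f g. f \<in> D \<Longrightarrow> g \<in> carrier A \<Longrightarrow> g \<otimes>\<^bsub>A\<^esub> f = \<one>\<^bsub>A\<^esub> \<Longrightarrow> g \<in> D"
  shows "subgroup D A"
proof (rule A.subgroupI)
  show "inv\<^bsub>A\<^esub> f \<in> D" if "f \<in> D" for f
    using assms(1) assms(4)[OF that, of "inv\<^bsub>A\<^esub> f"] that by auto
qed (use assms in auto)

text \<open>A descending series of \<open>Aut\<close> whose successive quotients embed in the cyclic
  group of order 4, its square-free successor \<open>\<int>\<^sub>3\<^sup>2\<close>, then
  \<open>\<int>\<^sub>3\<close>, and finally \<open>\<int>\<^sub>n\<^sup>3\<close>.\<close>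

definition phase_kernel where "phase_kernel = {f \<in> carrier A. phase f = 0}"
definition perm_kernel where "perm_kernel = {f \<in> carrier A. perm f = all_syms}"
definition shift_kernel where "shift_kernel = {f \<in> perm_kernel. angleK (shift f) = 0}"

lemma subgroup_phase_kernel: "subgroup phase_kernel A"
proof (rule subgroupI_kernel)
  fix f g assume "f \<in> phase_kernel" "g \<in> carrier A" "g \<otimes>\<^bsub>A\<^esub> f = \<one>\<^bsub>A\<^esub>"
  then show "g \<in> phase_kernel"
    using phase_mult[of g f] phase_less[of g] by (auto simp: phase_kernel_def phase_one)
qed (auto simp: phase_kernel_def phase_one phase_mult)

lemma subgroup_perm_kernel: "subgroup perm_kernel A"
proof (rule subgroupI_kernel)
  fix f g assume "f \<in> perm_kernel" "g \<in> carrier A" "g \<otimes>\<^bsub>A\<^esub> f = \<one>\<^bsub>A\<^esub>"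
  then show "g \<in> perm_kernel"
    using perm_mult[of g f] perm(1)[of g] by (auto simp: perm_kernel_def perm_one comp_all_syms_right perms_length carrier_A)
qed (auto simp: perm_kernel_def perm_one perm_mult)

lemma subgroup_shift_kernel: "subgroup shift_kernel A"
proof (rule subgroupI_kernel)
  fix f g assume f: "f \<in> shift_kernel" and g: "g \<in> carrier A" "g \<otimes>\<^bsub>A\<^esub> f = \<one>\<^bsub>A\<^esub>"
  then have "g \<in> perm_kernel"
    using perm_mult[of g f] perm(1)[of g] by (auto simp: shift_kernel_def perm_kernel_def perm_one comp_all_syms_right perms_length carrier_A)
  moreover have "mul (shift g) (shift f) = oneK"
    using f g \<open>g \<in> perm_kernel\<close> shift_mult[of g f] by (simp add: shift_kernel_def perm_kernel_def shift_one)
  then have "(angleK (shift g) + angleK (shift f)) mod 3 = 0"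
    by (metis angleK_mul angleK_one)
  then have "angleK (shift g) = 0"
    using f angleK_less[OF shift_in_K[OF g(1)]] by (simp add: shift_kernel_def)
  ultimately show "g \<in> shift_kernel"
    by (simp add: shift_kernel_def)
qed (auto simp: shift_kernel_def perm_kernel_def perm_one perm_mult shift_one shift_mult angleK_mul angleK_one)

lemma solvable: "solvable A"
proof -
  let ?w = "\<lambda>f g. f \<otimes>\<^bsub>A\<^esub> g \<otimes>\<^bsub>A\<^esub> inv\<^bsub>A\<^esub> f \<otimes>\<^bsub>A\<^esub> inv\<^bsub>A\<^esub> g"
  note w = A.commutator_mult
  have wc: "?w f g \<in> carrier A" if "f \<in> carrier A" "g \<in> carrier A" for f g
    using that by simp
  have 1: "derived A (carrier A) \<subseteq> phase_kernel"
  proof (rule A.derived_subset[OF subgroup_phase_kernel])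
    fix f g assume f: "f \<in> carrier A" "g \<in> carrier A"
    have "(phase (?w f g) + (phase g + phase f)) mod 4 = (phase f + phase g) mod 4"
      using arg_cong[OF w[OF f], of phase] f by (simp add: phase_mult mod_simps)
    then have "phase (?w f g) = 0"
      using phase_less[OF wc[OF f]] by (rule mod_shift_zero)
    then show "?w f g \<in> phase_kernel"
      using wc[OF f] by (simp add: phase_kernel_def)
  qed
  have 2: "derived A phase_kernel \<subseteq> perm_kernel"
  proof (rule A.derived_subset[OF subgroup_perm_kernel])
    fix f g assume f: "f \<in> phase_kernel" "g \<in> phase_kernel"
    then have fA: "f \<in> carrier A" "g \<in> carrier A"
      by (auto simp: phase_kernel_def)
    have "comp_perm (perm f) (perm g) = comp_perm (perm g) (perm f)"
      using perms_even_commute f by (auto simp: list_all_iff phase_kernel_def phase_def carrier_A perm)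
    then have c: "comp_perm (perm (?w f g)) (perm (g \<otimes>\<^bsub>A\<^esub> f)) = perm (g \<otimes>\<^bsub>A\<^esub> f)"
      using arg_cong[OF w[OF fA], of perm] fA wc[OF fA] by (simp add: perm_mult)
    have P: "perm (?w f g) \<in> set perms" "perm (g \<otimes>\<^bsub>A\<^esub> f) \<in> set perms"
      using wc[OF fA] fA by (meson A.m_closed carrier_A perm(1))+
    obtain m where m: "m \<in> set perms" "comp_perm (perm (g \<otimes>\<^bsub>A\<^esub> f)) m = all_syms"
      using P perms_inverse by blast
    have "comp_perm (perm (?w f g)) all_syms = all_syms"
      using comp_perm_assoc[of "perm (g \<otimes>\<^bsub>A\<^esub> f)" m "perm (?w f g)"] c P m perms_length by simp
    then have "perm (?w f g) = all_syms"
      using comp_all_syms_right P perms_length by simp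
    then show "?w f g \<in> perm_kernel"
      using wc[OF fA] by (simp add: perm_kernel_def)
  qed
  have 3: "derived A perm_kernel \<subseteq> shift_kernel"
  proof (rule A.derived_subset[OF subgroup_shift_kernel])
    fix f g assume f: "f \<in> perm_kernel" "g \<in> perm_kernel"
    have D: "?w f g \<in> perm_kernel" "g \<otimes>\<^bsub>A\<^esub> f \<in> perm_kernel"
      using f subgroup_perm_kernel by (simp_all add: subgroup.m_closed subgroup.m_inv_closed)
    have fA: "f \<in> carrier A" "g \<in> carrier A"
      using f by (auto simp: perm_kernel_def)
    have "mul (shift (?w f g)) (mul (shift g) (shift f)) = mul (shift f) (shift g)"
      using arg_cong[OF w[OF fA], of shift] f D by (simp add: shift_mult perm_kernel_def)
    from arg_cong[OF this, of angleK] have "(angleK (shift (?w f g)) + (angleK (shift g) + angleK (shift f))) mod 3 = (angleK (shift f) + angleK (shift g)) mod 3"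
      by (simp add: angleK_mul mod_simps)
    then have "angleK (shift (?w f g)) = 0"
      using angleK_less[OF shift_in_K[OF wc[OF fA]]] by (rule mod_shift_zero)
    then show "?w f g \<in> shift_kernel"
      using D by (simp add: shift_kernel_def)
  qed
  have 4: "derived A shift_kernel \<subseteq> {\<one>\<^bsub>A\<^esub>}"
  proof (rule A.derived_subset[OF A.triv_subgroup])
    fix f g assume f: "f \<in> shift_kernel" "g \<in> shift_kernel"
    have D: "?w f g \<in> shift_kernel" "g \<otimes>\<^bsub>A\<^esub> f \<in> shift_kernel"
      using f subgroup_shift_kernel by (simp_all add: subgroup.m_closed subgroup.m_inv_closed)
    have fA: "f \<in> carrier A" "g \<in> carrier A"
      using f by (auto simp: perm_kernel_def shift_kernel_def)
    have "mul (shift (?w f g)) (mul (shift g) (shift f)) = mul (shift f) (shift g)"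
      using arg_cong[OF w[OF fA], of shift] f D by (simp add: shift_mult perm_kernel_def shift_kernel_def)
    \<comment> \<open>Without powers of \<open>h\<close> the product in \<open>K\<close> is vector
      addition.\<close>
    also have "mul (shift f) (shift g) = mul (shift g) (shift f)"
      using f by (cases "shift f"; cases "shift g") (simp add: shift_kernel_def angleK_def add.commute)
    finally have "shift (?w f g) = oneK"
      using mul_cancel shift_in_K wc fA by (meson mul_closed)
    then have "?w f g x = x" if "x \<in> V" for x
      using left_translation[of "?w f g" x] D that by (simp add: shift_kernel_def perm_kernel_def in_V)
    then have "?w f g = \<one>\<^bsub>A\<^esub>"
      using wc[OF fA] unfolding one_A by (intro extensionalityI[of _ V]) (auto simp: carrier_A)
    then show "?w f g \<in> {\<one>\<^bsub>A\<^esub>}" by simp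
  qed
  have "(derived A ^^ 4) (carrier A) = derived A (derived A (derived A (derived A (carrier A))))"
    by (simp add: numeral_eq_Suc)
  also have "\<dots> \<subseteq> {\<one>\<^bsub>A\<^esub>}"
    using 1 2 3 4 A.mono_derived by (meson order_trans)
  finally have "(derived A ^^ 4) (carrier A) \<subseteq> {\<one>\<^bsub>A\<^esub>}" .
  \<comment> \<open>An iterated derived subgroup contains the identity, which turns the inclusion
    into an equality.\<close>
  moreover have "\<one>\<^bsub>A\<^esub> \<in> (derived A ^^ 4) (carrier A)"
    using A.exp_of_derived_is_subgroup[OF A.subgroup_self] by (rule subgroup.one_closed)
  ultimately have "(derived A ^^ 4) (carrier A) = {\<one>\<^bsub>A\<^esub>}"
    by blast
  then show ?thesis
    unfolding solvable_def by (intro A.trivial_derived_seq_imp_solvable[OF A.subgroup_self])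
qed

end

theorem theorem3p1:
  fixes n :: nat and r :: int
  assumes "n \<ge> 7" and "(r ^ 2 + r + 1) mod int n = 0"
  shows "graph_connected (NCG_V n) (NCG_adj n r)
       \<and> cubic (NCG_V n) (NCG_adj n r)
       \<and> arc_transitive (NCG_V n) (NCG_adj n r)
       \<and> \<not> is_Cayley_graph (NCG_V n) (NCG_adj n r)
       \<and> solvable (Aut (NCG_V n) (NCG_adj n r))
       \<and> type_2_2 (NCG_V n) (NCG_adj n r) (carrier (Aut (NCG_V n) (NCG_adj n r)))"
proof -
  interpret ncg n r
    using assms by unfold_locales
  show ?thesis
    using graph_connected cubic arc_transitive not_Cayley solvable type_2_2 by blast
qed

end
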